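(* Let $G$ be a discrete group. Then the map $\mathfrak{c}_*\colon \pi_1(E_{\mathrm{com}}G)\to \pi_1(B[G,G])\cong[G,G]$ induced by $\mathfrak{c}\colon E_{\mathrm{com}}G\to B[G,G]$ is a surjective homomorphism. In particular, $G$ is abelian if and only if $\pi_1(E_{\mathrm{com}}G)=1$.
   Context: Commutators are $[x,y]=x^{-1}y^{-1}xy$, and $[G,G]$ is the commutator subgroup. An $(n+1)$-tuple $(g_0,\dots,g_n)$ of elements of $G$ is affinely commutative if the consecutive quotients $g_0^{-1}g_1,\dots,g_{n-1}^{-1}g_n$ pairwise commute. $\mathrm{AfCom}_\bullet(G)$ is the simplicial set whose $n$-simplices are the affinely commutative $(n+1)$-tuples, with $d_i$ deleting the $i$-th coordinate and $s_i$ repeating the $i$-th coordinate. Here $E_{\mathrm{com}}G$ is the geometric realization $|\mathrm{AfCom}_\bullet(G)|$; it is a model for the homotopy fiber of the canonical map $B_{\mathrm{com}}G\to BG$, where $B_{\mathrm{com}}G$ is the realization of the simplicial subset of the nerve $NG$ whose $n$-simplices are the $n$-tuples of pairwise commuting elements. The map $\mathfrak{c}\colon E_{\mathrm{com}}G\to B[G,G]$ is the realization of the simplicial map $\mathfrak{c}_\bullet\colon\mathrm{AfCom}_\bullet(G)\to N[G,G]$ given by $(g_0,\dots,g_n)\mapsto([g_0,g_1],\dots,[g_{n-1},g_n])$, where $N[G,G]$ is the nerve of $[G,G]$ viewed as a one-object category (with $d_0$, $d_n$ dropping the first, last coordinate, the other $d_i$ multiplying adjacent coordinates, and degeneracies inserting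 the identity). Fundamental groups are based at the vertex $e\in G$ and its image; $\pi_1(B[G,G])\cong[G,G]$ is the standard identification sending the loop given by the 1-simplex $x$ to $x$. *)

theory Defs
  imports "HOL-Homology.Homology" "HOL-Algebra.Generated_Groups"
begin

section \<open>Simplicial sets\<close>

text \<open>\<open>face X n i\<close> is the map \<open>d\<^sub>i\<close> from \<open>n\<close>-simplices to \<open>(n-1)\<close>-simplices and \<open>degen X n i\<close> the
  map \<open>s\<^sub>i\<close> from \<open>n\<close>-simplices to \<open>(n+1)\<close>-simplices.\<close>

record 'a sset =
  simplices :: "nat \<Rightarrow> 'a set"
  face :: "nat \<Rightarrow> nat \<Rightarrow> 'a \<Rightarrow> 'a"
  degen :: "nat \<Rightarrow> nat \<Rightarrow> 'a \<Rightarrow> 'a"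

definition simplicial_set :: "'a sset \<Rightarrow> bool" where
  "simplicial_set X \<longleftrightarrow>
    (\<forall>n. \<forall>i\<le>Suc n. face X (Suc n) i \<in> simplices X (Suc n) \<rightarrow> simplices X n) \<and>
    (\<forall>n. \<forall>i\<le>n. degen X n i \<in> simplices X n \<rightarrow> simplices X (Suc n)) \<and>
    (\<forall>n i j. \<forall>x \<in> simplices X (Suc (Suc n)). i < j \<longrightarrow> j \<le> Suc (Suc n) \<longrightarrow>
        face X (Suc n) i (face X (Suc (Suc n)) j x) =
        face X (Suc n) (j - 1) (face X (Suc (Suc n)) i x)) \<and>
    (\<forall>n i j. \<forall>x \<in> simplices X n. i \<le> j \<longrightarrow> j \<le> n \<longrightarrow>
        degen X (Suc n) i (degen X n j x) = degen X (Suc n) (Suc j) (degen X n i x)) \<and>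
    (\<forall>n i j. \<forall>x \<in> simplices X (Suc n). i < j \<longrightarrow> j \<le> Suc n \<longrightarrow>
        face X (Suc (Suc n)) i (degen X (Suc n) j x) = degen X n (j - 1) (face X (Suc n) i x)) \<and>
    (\<forall>n j. \<forall>x \<in> simplices X n. j \<le> n \<longrightarrow>
        face X (Suc n) j (degen X n j x) = x \<and> face X (Suc n) (Suc j) (degen X n j x) = x) \<and>
    (\<forall>n i j. \<forall>x \<in> simplices X (Suc n). Suc j < i \<longrightarrow> i \<le> Suc (Suc n) \<longrightarrow>
        face X (Suc (Suc n)) i (degen X (Suc n) j x) = degen X n j (face X (Suc n) (i - 1) x))"

definition simplicial_map :: "'a sset \<Rightarrow> 'b sset \<Rightarrow> (nat \<Rightarrow> 'a \<Rightarrow> 'b) \<Rightarrow> bool" where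
  "simplicial_map X Y f \<longleftrightarrow>
    (\<forall>n. f n \<in> simplices X n \<rightarrow> simplices Y n) \<and>
    (\<forall>n. \<forall>i\<le>Suc n. \<forall>x \<in> simplices X (Suc n).
        f n (face X (Suc n) i x) = face Y (Suc n) i (f (Suc n) x)) \<and>
    (\<forall>n. \<forall>i\<le>n. \<forall>x \<in> simplices X n.
        f (Suc n) (degen X n i x) = degen Y n i (f n x))"


section \<open>Geometric realization\<close>

definition quotient_topology :: "'a topology \<Rightarrow> ('a \<times> 'a) set \<Rightarrow> 'a set topology" where
  "quotient_topology X R =
    topology (\<lambda>U. U \<subseteq> topspace X // R \<and> openin X {x \<in> topspace X. R `` {x} \<in> U})"

lemma openin_quotient_topology:
  "openin (quotient_topology X R) U \<longleftrightarrow>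
    U \<subseteq> topspace X // R \<and> openin X {x \<in> topspace X. R `` {x} \<in> U}"
proof -
  have "istopology (\<lambda>U. U \<subseteq> topspace X // R \<and> openin X {x \<in> topspace X. R `` {x} \<in> U})"
    unfolding istopology_def
  proof (intro conjI allI impI)
    fix S T
    assume S: "S \<subseteq> topspace X // R \<and> openin X {x \<in> topspace X. R `` {x} \<in> S}"
      and T: "T \<subseteq> topspace X // R \<and> openin X {x \<in> topspace X. R `` {x} \<in> T}"
    show "S \<inter> T \<subseteq> topspace X // R" using S by blast
    have "{x \<in> topspace X. R `` {x} \<in> S \<inter> T} =
        {x \<in> topspace X. R `` {x} \<in> S} \<inter> {x \<in> topspace X. R `` {x} \<in> T}" by blast
    moreover have "openin X \<dots>"
      using S T by (intro openin_Int) simp_all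
    ultimately show "openin X {x \<in> topspace X. R `` {x} \<in> S \<inter> T}"
      by simp
  next
    fix K
    assume K: "\<forall>S\<in>K. S \<subseteq> topspace X // R \<and> openin X {x \<in> topspace X. R `` {x} \<in> S}"
    then show "\<Union>K \<subseteq> topspace X // R" by blast
    have "{x \<in> topspace X. R `` {x} \<in> \<Union>K} =
        \<Union>((\<lambda>S. {x \<in> topspace X. R `` {x} \<in> S}) ` K)" by blast
    moreover have "openin X \<dots>"
      using K by (intro openin_Union) blast
    ultimately show "openin X {x \<in> topspace X. R `` {x} \<in> \<Union>K}"
      by simp
  qed
  then show ?thesis
    by (simp add: quotient_topology_def)
qed

lemma topspace_quotient_topology [simp]:
  "topspace (quotient_topology X R) = topspace X // R"
proof
  show "topspace (quotient_topology X R) \<subseteq> topspace X // R"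
    using openin_topspace[of "quotient_topology X R"]
    unfolding openin_quotient_topology by (rule conjunct1)
  have "{x \<in> topspace X. R `` {x} \<in> topspace X // R} = topspace X"
    by (auto intro: quotientI)
  then show "topspace X // R \<subseteq> topspace (quotient_topology X R)"
    by (intro openin_subset) (simp only: openin_quotient_topology order_refl openin_topspace)
qed

lemma quotient_map_quotient_topology:
  "quotient_map X (quotient_topology X R) (\<lambda>x. R `` {x})"
proof -
  have "(\<lambda>x. R `` {x}) ` topspace X = topspace X // R"
    unfolding quotient_def by blast
  then show ?thesis
    unfolding quotient_map_def topspace_quotient_topology openin_quotient_topology by simp
qed

text \<open>Companion of \<^const>\<open>simplical_face\<close>: the affine map of standard simplices induced by the
  surjection that hits \<open>k\<close> twice.\<close>

definition simplical_degen :: "nat \<Rightarrow> (nat \<Rightarrow> 'a) \<Rightarrow> nat \<Rightarrow> 'a::comm_monoid_add" where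
  "simplical_degen k x =
    (\<lambda>i. if i < k then x i else if i = k then x i + x (Suc i) else x (Suc i))"

text \<open>The point \<open>t\<close> in the copy of the standard simplex belonging to the \<open>n\<close>-simplex \<open>x\<close> is
  \<open>((n, x), t)\<close>.\<close>

type_synonym 'a cell_pt = "(nat \<times> 'a) \<times> (nat \<Rightarrow> real)"

definition cells :: "'a sset \<Rightarrow> 'a cell_pt topology" where
  "cells X = sum_topology (\<lambda>(n, x). subtopology (powertop_real UNIV) (standard_simplex n))
    (SIGMA n:UNIV. simplices X n)"

definition glue :: "'a sset \<Rightarrow> ('a cell_pt \<times> 'a cell_pt) set" where
  "glue X =
    {(((n, face X (Suc n) i x), t), ((Suc n, x), simplical_face i t)) | n i x t.
        x \<in> simplices X (Suc n) \<and> i \<le> Suc n \<and> t \<in> standard_simplex n} \<union>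
    {(((Suc n, degen X n i x), t), ((n, x), simplical_degen i t)) | n i x t.
        x \<in> simplices X n \<and> i \<le> n \<and> t \<in> standard_simplex (Suc n)}"

definition realization_rel ::
    "'a sset \<Rightarrow> ('a cell_pt \<times> 'a cell_pt) set" where
  "realization_rel X =
    (glue X \<union> (glue X)\<inverse>)\<^sup>* \<inter> topspace (cells X) \<times> topspace (cells X)"

definition realization_pt :: "'a sset \<Rightarrow> nat \<Rightarrow> 'a \<Rightarrow> (nat \<Rightarrow> real) \<Rightarrow> 'a cell_pt set"
  where "realization_pt X n x t = realization_rel X `` {((n, x), t)}"

definition realization :: "'a sset \<Rightarrow> 'a cell_pt set topology" where
  "realization X = quotient_topology (cells X) (realization_rel X)"

text \<open>The union below ranges over equal sets whenever \<open>f\<close> is a simplicial map into \<open>Y\<close>.\<close>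

definition realization_map ::
    "'b sset \<Rightarrow> (nat \<Rightarrow> 'a \<Rightarrow> 'b) \<Rightarrow> 'a cell_pt set
      \<Rightarrow> 'b cell_pt set" where
  "realization_map Y f A = (\<Union>((n, x), t) \<in> A. realization_pt Y n (f n x) t)"

definition realization_vertex :: "'a sset \<Rightarrow> 'a \<Rightarrow> 'a cell_pt set" where
  "realization_vertex X v = realization_pt X 0 v (\<lambda>j. if j = 0 then 1 else 0)"

text \<open>The path along a 1-simplex \<open>x\<close>, running from \<open>d\<^sub>1 x\<close> to \<open>d\<^sub>0 x\<close>.\<close>

definition edge_path :: "'a sset \<Rightarrow> 'a \<Rightarrow> real \<Rightarrow> 'a cell_pt set" where
  "edge_path X x s =
    realization_pt X 1 x (\<lambda>j. if j = 0 then 1 - s else if j = 1 then s else 0)"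


section \<open>The fundamental group\<close>

text \<open>\<^const>\<open>joinpaths\<close> and \<^const>\<open>homotopic_paths\<close> require a topological type class on the points, so
  their definitions are repeated here for abstract topologies. Paths are total functions on the
  reals of which only the values on the unit interval matter.\<close>

definition loops :: "'a topology \<Rightarrow> 'a \<Rightarrow> (real \<Rightarrow> 'a) set" where
  "loops X b = {p. pathin X p \<and> p 0 = b \<and> p 1 = b}"

definition loop_join :: "(real \<Rightarrow> 'a) \<Rightarrow> (real \<Rightarrow> 'a) \<Rightarrow> real \<Rightarrow> 'a" where
  "loop_join p q = (\<lambda>s. if s \<le> 1/2 then p (2 * s) else q (2 * s - 1))"

definition loop_class :: "'a topology \<Rightarrow> 'a \<Rightarrow> (real \<Rightarrow> 'a) \<Rightarrow> (real \<Rightarrow> 'a) set" where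
  "loop_class X b p =
    {q. homotopic_with (\<lambda>r. r 0 = b \<and> r 1 = b) (top_of_set {0..1}) X p q}"

definition fundamental_group :: "'a topology \<Rightarrow> 'a \<Rightarrow> (real \<Rightarrow> 'a) set monoid" where
  "fundamental_group X b =
    \<lparr>carrier = loop_class X b ` loops X b,
     mult = (\<lambda>A B. \<Union>p\<in>A. \<Union>q\<in>B. loop_class X b (loop_join p q)),
     one = loop_class X b (\<lambda>_. b)\<rparr>"

definition induced_map ::
    "'b topology \<Rightarrow> 'b \<Rightarrow> ('a \<Rightarrow> 'b) \<Rightarrow> (real \<Rightarrow> 'a) set \<Rightarrow> (real \<Rightarrow> 'b) set" where
  "induced_map Y c f A = (\<Union>p\<in>A. loop_class Y c (f \<circ> p))"


section \<open>Affinely commutative tuples, nerves and the map \<open>\<cc>\<close>\<close>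

definition commutator :: "('a, 'b) monoid_scheme \<Rightarrow> 'a \<Rightarrow> 'a \<Rightarrow> 'a" where
  "commutator G x y = inv\<^bsub>G\<^esub> x \<otimes>\<^bsub>G\<^esub> inv\<^bsub>G\<^esub> y \<otimes>\<^bsub>G\<^esub> x \<otimes>\<^bsub>G\<^esub> y"

text \<open>\<^const>\<open>derived\<close> is generated by the elements \<open>x y x\<inverse> y\<inverse>\<close>; these are the elements
  \<^term>\<open>commutator G (inv\<^bsub>G\<^esub> x) (inv\<^bsub>G\<^esub> y)\<close>, so the subgroup is the same.\<close>

definition commutator_subgroup :: "('a, 'b) monoid_scheme \<Rightarrow> ('a, 'b) monoid_scheme" where
  "commutator_subgroup G = G\<lparr>carrier := derived G (carrier G)\<rparr>"

text \<open>An \<open>(n+1)\<close>-tuple \<open>(g\<^sub>0, \<dots>, g\<^sub>n)\<close> is a list of length \<open>n+1\<close>.\<close>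

definition affinely_commutative :: "('a, 'b) monoid_scheme \<Rightarrow> 'a list \<Rightarrow> bool" where
  "affinely_commutative G gs \<longleftrightarrow>
    (\<forall>i j. Suc i < length gs \<longrightarrow> Suc j < length gs \<longrightarrow>
      (inv\<^bsub>G\<^esub> (gs ! i) \<otimes>\<^bsub>G\<^esub> gs ! Suc i) \<otimes>\<^bsub>G\<^esub> (inv\<^bsub>G\<^esub> (gs ! j) \<otimes>\<^bsub>G\<^esub> gs ! Suc j) =
      (inv\<^bsub>G\<^esub> (gs ! j) \<otimes>\<^bsub>G\<^esub> gs ! Suc j) \<otimes>\<^bsub>G\<^esub> (inv\<^bsub>G\<^esub> (gs ! i) \<otimes>\<^bsub>G\<^esub> gs ! Suc i))"

definition AfCom :: "('a, 'b) monoid_scheme \<Rightarrow> 'a list sset" where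
  "AfCom G =
    \<lparr>simplices = (\<lambda>n. {gs. length gs = Suc n \<and> set gs \<subseteq> carrier G \<and> affinely_commutative G gs}),
     face = (\<lambda>n i gs. take i gs @ drop (Suc i) gs),
     degen = (\<lambda>n i gs. take (Suc i) gs @ drop i gs)\<rparr>"

definition nerve :: "('a, 'b) monoid_scheme \<Rightarrow> 'a list sset" where
  "nerve H =
    \<lparr>simplices = (\<lambda>n. {hs. length hs = n \<and> set hs \<subseteq> carrier H}),
     face = (\<lambda>n i hs. if i = 0 then tl hs else if i = n then butlast hs
               else take (i - 1) hs @ [hs ! (i - 1) \<otimes>\<^bsub>H\<^esub> hs ! i] @ drop (Suc i) hs),
     degen = (\<lambda>n i hs. take i hs @ [\<one>\<^bsub>H\<^esub>] @ drop i hs)\<rparr>"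

definition comm_simp :: "('a, 'b) monoid_scheme \<Rightarrow> nat \<Rightarrow> 'a list \<Rightarrow> 'a list" where
  "comm_simp G n gs = map (\<lambda>i. commutator G (gs ! i) (gs ! Suc i)) [0..<n]"

subsection \<open>\<open>AfCom G\<close> and \<open>nerve H\<close> are simplicial sets and \<open>\<cc>\<close> is a simplicial map\<close>

lemma (in group) inv_mult_telescope:
  assumes "x \<in> carrier G" "y \<in> carrier G" "z \<in> carrier G"
  shows "(inv x \<otimes> y) \<otimes> (inv y \<otimes> z) = inv x \<otimes> z"
proof -
  have "y \<otimes> (inv y \<otimes> z) = z"
    using assms by (simp flip: m_assoc)
  then show ?thesis
    using assms by (simp add: m_assoc)
qed

lemma (in group) commute_mult:
  assumes "a \<in> carrier G" "b \<in> carrier G" "c \<in> carrier G" "a \<otimes> c = c \<otimes> a" "b \<otimes> c = c \<otimes> b"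
  shows "(a \<otimes> b) \<otimes> c = c \<otimes> (a \<otimes> b)"
proof -
  have "(a \<otimes> b) \<otimes> c = a \<otimes> (c \<otimes> b)"
    using assms by (simp add: m_assoc)
  also have "\<dots> = (c \<otimes> a) \<otimes> b"
    using assms by (simp flip: m_assoc)
  finally show ?thesis
    using assms by (simp add: m_assoc)
qed

lemma nth_delete: "i < length xs \<Longrightarrow> Suc j < length xs \<Longrightarrow>
   (take i xs @ drop (Suc i) xs) ! j = (if j < i then xs ! j else xs ! Suc j)"
  by (auto simp: nth_append min_def)

lemma nth_repeat:
  assumes "i < length xs" "j \<le> length xs"
  shows "(take (Suc i) xs @ drop i xs) ! j = (if j \<le> i then xs ! j else xs ! (j - 1))"
proof (cases "j \<le> i")
  case True
  with assms show ?thesis by (simp add: nth_append)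
next
  case False
  then obtain m where m: "j = Suc (i + m)"
    by (metis less_imp_Suc_add not_le)
  have "length (take (Suc i) xs) = Suc i"
    using assms(1) by simp
  then have "(take (Suc i) xs @ drop i xs) ! j = drop i xs ! m"
    by (simp only: m nth_append) simp
  with assms show ?thesis by (simp add: m)
qed

lemma nth_insert:
  assumes "i \<le> length xs" "j \<le> length xs"
  shows "(take i xs @ [a] @ drop i xs) ! j =
    (if j < i then xs ! j else if j = i then a else xs ! (j - 1))"
proof (cases "j \<le> i")
  case True
  with assms show ?thesis by (simp add: nth_append)
next
  case False
  then obtain m where m: "j = Suc (i + m)"
    by (metis less_imp_Suc_add not_le)
  have "length (take i xs) = i"
    using assms(1) by simp
  then have "(take i xs @ [a] @ drop i xs) ! j = drop i xs ! m"
    by (simp only: m nth_append) simp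
  with assms show ?thesis by (simp add: m)
qed

lemma face_nerve_nth:
  assumes l: "length hs = Suc n" and i: "i \<le> Suc n" and j: "j < n"
  shows "face (nerve H) (Suc n) i hs ! j =
    (if Suc j < i then hs ! j else if Suc j = i \<and> i \<le> n then hs ! j \<otimes>\<^bsub>H\<^esub> hs ! Suc j
     else if i \<le> j then hs ! Suc j else hs ! j)"
proof -
  consider "i = 0" | "i = Suc n" | k where "i = Suc k" "k < n"
    using i by (cases i) (simp, metis le_neq_implies_less Suc_le_mono)
  then show ?thesis
  proof cases
    case 1
    with l j show ?thesis by (simp add: nerve_def nth_tl)
  next
    case 2
    with l j show ?thesis by (simp add: nerve_def nth_butlast)
  next
    case 3
    consider "j < k" | "j = k" | m where "j = Suc (k + m)"
      by (metis less_imp_Suc_add linorder_neqE_nat)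
    then show ?thesis
    proof cases
      case 1
      with 3 l j show ?thesis by (simp add: nerve_def nth_append)
    next
      case 2
      with 3 l j show ?thesis by (simp add: nerve_def nth_append)
    next
      case 3
      with \<open>i = Suc k\<close> \<open>k < n\<close> l j show ?thesis by (simp add: nerve_def nth_append)
    qed
  qed
qed

lemma length_face_nerve: "length hs = Suc n \<Longrightarrow> i \<le> Suc n \<Longrightarrow> length (face (nerve H) (Suc n) i hs) = n"
  by (auto simp: nerve_def)

lemma degen_nerve_nth:
  "length hs = n \<Longrightarrow> i \<le> n \<Longrightarrow> j \<le> n \<Longrightarrow> degen (nerve H) n i hs ! j =
    (if j < i then hs ! j else if j = i then \<one>\<^bsub>H\<^esub> else hs ! (j - 1))"
  unfolding nerve_def by (simp add: nth_insert del: append_Cons append_Nil)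

lemma length_degen_nerve: "length hs = n \<Longrightarrow> i \<le> n \<Longrightarrow> length (degen (nerve H) n i hs) = Suc n"
  by (auto simp: nerve_def)

lemma simplices_nerve: "simplices (nerve H) n = {hs. length hs = n \<and> (\<forall>k<n. hs ! k \<in> carrier H)}"
  by (simp add: nerve_def subset_code(1) all_set_conv_all_nth cong: conj_cong)

lemma simplicial_set_nerve:
  assumes "group H" shows "simplicial_set (nerve H)"
proof -
  interpret group H by fact
  show ?thesis unfolding simplicial_set_def
    apply (intro conjI)
    subgoal by (auto simp: simplices_nerve face_nerve_nth length_face_nerve)
    subgoal by (auto simp: simplices_nerve degen_nerve_nth length_degen_nerve less_Suc_eq_le)
    subgoal by (intro allI ballI impI nth_equalityI; auto simp: simplices_nerve face_nerve_nth length_face_nerve m_assoc)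
    subgoal by (intro allI ballI impI nth_equalityI; auto simp: simplices_nerve degen_nerve_nth length_degen_nerve less_Suc_eq_le)
    subgoal by (intro allI ballI impI nth_equalityI; auto simp: simplices_nerve degen_nerve_nth length_degen_nerve face_nerve_nth length_face_nerve less_Suc_eq_le; linarith?)
    subgoal by (intro allI ballI impI conjI nth_equalityI; auto simp: simplices_nerve degen_nerve_nth length_degen_nerve face_nerve_nth length_face_nerve less_Suc_eq_le)
    subgoal by (intro allI ballI impI nth_equalityI; auto simp: simplices_nerve degen_nerve_nth length_degen_nerve face_nerve_nth length_face_nerve less_Suc_eq_le)
    done
qed

lemma length_face_AfCom: "length gs = Suc (Suc n) \<Longrightarrow> i \<le> Suc n \<Longrightarrow> length (face (AfCom G) (Suc n) i gs) = Suc n"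
  by (auto simp: AfCom_def)
lemma length_degen_AfCom: "length gs = Suc n \<Longrightarrow> i \<le> n \<Longrightarrow> length (degen (AfCom G) n i gs) = Suc (Suc n)"
  by (auto simp: AfCom_def)
lemma face_AfCom_nth: "length gs = Suc (Suc n) \<Longrightarrow> i \<le> Suc n \<Longrightarrow> j \<le> n \<Longrightarrow>
   face (AfCom G) (Suc n) i gs ! j = (if j < i then gs ! j else gs ! Suc j)"
  unfolding AfCom_def by (simp add: nth_delete)
lemma degen_AfCom_nth: "length gs = Suc n \<Longrightarrow> i \<le> n \<Longrightarrow> j \<le> Suc n \<Longrightarrow>
   degen (AfCom G) n i gs ! j = (if j \<le> i then gs ! j else gs ! (j - 1))"
  unfolding AfCom_def by (simp add: nth_repeat)
lemma simplices_AfCom: "simplices (AfCom G) n =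
   {gs. length gs = Suc n \<and> (\<forall>k\<le>n. gs ! k \<in> carrier G) \<and> affinely_commutative G gs}"
  by (simp add: AfCom_def subset_code(1) all_set_conv_all_nth less_Suc_eq_le cong: conj_cong)

lemma affinely_commutative_face:
  fixes G (structure)
  assumes "group G" "gs \<in> simplices (AfCom G) (Suc n)" "i \<le> Suc n"
  shows "affinely_commutative G (face (AfCom G) (Suc n) i gs)"
proof -
  interpret group G by fact
  let ?h = "face (AfCom G) (Suc n) i gs"
  define q where "q k = inv (gs ! k) \<otimes> gs ! Suc k" for k
  have l: "length gs = Suc (Suc n)" and c: "\<And>k. k \<le> Suc n \<Longrightarrow> gs ! k \<in> carrier G"
    and a: "\<And>k l. k \<le> n \<Longrightarrow> l \<le> n \<Longrightarrow> q k \<otimes> q l = q l \<otimes> q k"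
    using assms by (auto simp: simplices_AfCom q_def affinely_commutative_def)
  have qc: "q k \<in> carrier G" if "k \<le> n" for k using c that by (simp add: q_def)
  have 1: "\<exists>k\<le>n. \<exists>l\<le>n. inv (?h ! j) \<otimes> ?h ! Suc j = q k \<or> inv (?h ! j) \<otimes> ?h ! Suc j = q k \<otimes> q l" if "j < n" for j
  proof -
    have e: "?h ! j = (if j < i then gs ! j else gs ! Suc j)"
       "?h ! Suc j = (if Suc j < i then gs ! Suc j else gs ! Suc (Suc j))"
      using that assms l by (simp_all add: face_AfCom_nth)
    consider "Suc j < i" | "Suc j = i" | "i \<le> j" by linarith
    then show ?thesis
    proof cases
      case 1
      then have "inv (?h ! j) \<otimes> ?h ! Suc j = q j" by (simp add: e q_def)
      moreover have "j \<le> n" using that by simp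
      ultimately show ?thesis by blast
    next
      case 2
      have "q j \<otimes> q (Suc j) = inv (gs ! j) \<otimes> gs ! Suc (Suc j)"
        unfolding q_def using c that by (intro inv_mult_telescope) auto
      moreover have "?h ! j = gs ! j" "?h ! Suc j = gs ! Suc (Suc j)"
        unfolding e using 2 by simp_all
      ultimately have "inv (?h ! j) \<otimes> ?h ! Suc j = q j \<otimes> q (Suc j)" by simp
      moreover have "j \<le> n" "Suc j \<le> n" using that by simp_all
      ultimately show ?thesis by blast
    next
      case 3
      then have "inv (?h ! j) \<otimes> ?h ! Suc j = q (Suc j)" by (simp add: e q_def)
      moreover have "Suc j \<le> n" using that by simp
      ultimately show ?thesis by blast
    qed
  qed
  have 2: "inv (?h ! j) \<otimes> ?h ! Suc j \<in> carrier G \<and>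
      (inv (?h ! j) \<otimes> ?h ! Suc j) \<otimes> w = w \<otimes> (inv (?h ! j) \<otimes> ?h ! Suc j)"
    if j: "j < n" and w: "w \<in> carrier G" "\<And>k. k \<le> n \<Longrightarrow> q k \<otimes> w = w \<otimes> q k" for j w
  proof -
    obtain k l where kl: "k \<le> n" "l \<le> n" and
      "inv (?h ! j) \<otimes> ?h ! Suc j = q k \<or> inv (?h ! j) \<otimes> ?h ! Suc j = q k \<otimes> q l"
      using 1[OF j] by blast
    then show ?thesis
    proof (elim disjE)
      assume "inv (?h ! j) \<otimes> ?h ! Suc j = q k"
      with kl w qc show ?thesis by simp
    next
      assume "inv (?h ! j) \<otimes> ?h ! Suc j = q k \<otimes> q l"
      with kl w qc show ?thesis by (simp add: commute_mult)
    qed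
  qed
  have "(inv (?h ! j) \<otimes> ?h ! Suc j) \<otimes> (inv (?h ! k) \<otimes> ?h ! Suc k) =
     (inv (?h ! k) \<otimes> ?h ! Suc k) \<otimes> (inv (?h ! j) \<otimes> ?h ! Suc j)" if jk: "j < n" "k < n" for j k
  proof -
    have hk: "inv (?h ! k) \<otimes> ?h ! Suc k \<in> carrier G"
      using 2[OF jk(2) one_closed] qc by simp
    have "q l \<otimes> (inv (?h ! k) \<otimes> ?h ! Suc k) = (inv (?h ! k) \<otimes> ?h ! Suc k) \<otimes> q l" if "l \<le> n" for l
      using 2[OF jk(2) qc[OF that] a[OF _ that]] by simp
    with 2[OF jk(1) hk] show ?thesis by blast
  qed
  then show ?thesis using l assms
    by (simp add: affinely_commutative_def length_face_AfCom)
qed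

lemma affinely_commutative_degen:
  fixes G (structure)
  assumes "group G" "gs \<in> simplices (AfCom G) n" "i \<le> n"
  shows "affinely_commutative G (degen (AfCom G) n i gs)"
proof -
  interpret group G by fact
  let ?h = "degen (AfCom G) n i gs"
  define q where "q k = inv (gs ! k) \<otimes> gs ! Suc k" for k
  have l: "length gs = Suc n" and c: "\<And>k. k \<le> n \<Longrightarrow> gs ! k \<in> carrier G"
    and a: "\<And>k l. k < n \<Longrightarrow> l < n \<Longrightarrow> q k \<otimes> q l = q l \<otimes> q k"
    using assms by (auto simp: simplices_AfCom q_def affinely_commutative_def)
  have qc: "q k \<in> carrier G" if "k < n" for k using c that by (simp add: q_def)
  have 1: "inv (?h ! j) \<otimes> ?h ! Suc j = \<one> \<or> (\<exists>k<n. inv (?h ! j) \<otimes> ?h ! Suc j = q k)"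
    if j: "j \<le> n" for j
  proof -
    have e: "?h ! j = (if j \<le> i then gs ! j else gs ! (j - 1))"
      "?h ! Suc j = (if Suc j \<le> i then gs ! Suc j else gs ! j)"
      using j assms(3) l by (simp_all add: degen_AfCom_nth)
    consider "j < i" | "j = i" | "i < j" by linarith
    then show ?thesis
    proof cases
      case 1
      then have "inv (?h ! j) \<otimes> ?h ! Suc j = q j" by (simp add: e q_def)
      moreover have "j < n" using 1 assms(3) by simp
      ultimately show ?thesis by blast
    next
      case 2
      then have "?h ! j = gs ! j" "?h ! Suc j = gs ! j" unfolding e by simp_all
      with c[OF j] show ?thesis by simp
    next
      case 3
      then have "inv (?h ! j) \<otimes> ?h ! Suc j = q (j - 1)" by (simp add: e q_def)
      moreover have "j - 1 < n" using 3 j by simp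
      ultimately show ?thesis by blast
    qed
  qed
  have "(inv (?h ! j) \<otimes> ?h ! Suc j) \<otimes> (inv (?h ! k) \<otimes> ?h ! Suc k) =
     (inv (?h ! k) \<otimes> ?h ! Suc k) \<otimes> (inv (?h ! j) \<otimes> ?h ! Suc j)" if "j \<le> n" "k \<le> n" for j k
    using 1[OF that(1)] 1[OF that(2)] by (elim disjE exE conjE) (simp_all only: a qc l_one r_one one_closed)
  then show ?thesis using l assms
    by (simp add: affinely_commutative_def length_degen_AfCom)
qed

lemma simplicial_set_AfCom:
  fixes G (structure)
  assumes "group G" shows "simplicial_set (AfCom G)"
proof -
  interpret group G by fact
  show ?thesis unfolding simplicial_set_def
    apply (intro conjI)
    subgoal using affinely_commutative_face[OF assms] by (auto simp: simplices_AfCom face_AfCom_nth length_face_AfCom)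
    subgoal using affinely_commutative_degen[OF assms] by (auto simp: simplices_AfCom degen_AfCom_nth length_degen_AfCom)
    subgoal by (intro allI ballI impI nth_equalityI; auto simp: simplices_AfCom face_AfCom_nth length_face_AfCom)
    subgoal by (intro allI ballI impI nth_equalityI; auto simp: simplices_AfCom degen_AfCom_nth length_degen_AfCom less_Suc_eq_le)
    subgoal by (intro allI ballI impI nth_equalityI; auto simp: simplices_AfCom degen_AfCom_nth length_degen_AfCom face_AfCom_nth length_face_AfCom less_Suc_eq_le)
    subgoal by (intro allI ballI impI conjI nth_equalityI; auto simp: simplices_AfCom degen_AfCom_nth length_degen_AfCom face_AfCom_nth length_face_AfCom less_Suc_eq_le)
    subgoal by (intro allI ballI impI nth_equalityI; auto simp: simplices_AfCom degen_AfCom_nth length_degen_AfCom face_AfCom_nth length_face_AfCom less_Suc_eq_le)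
    done
qed

lemma (in group) commutator_in_derived:
  assumes "x \<in> carrier G" "y \<in> carrier G"
  shows "commutator G x y \<in> derived G (carrier G)"
proof -
  have "inv x \<otimes> inv y \<otimes> inv (inv x) \<otimes> inv (inv y) \<in> derived G (carrier G)"
    unfolding derived_def
    by (intro generate.incl UN_I[of "inv x"] UN_I[of "inv y"] singletonI inv_closed assms)
  then show ?thesis using assms by (simp add: commutator_def)
qed

lemma (in group) commutator_mult:
  assumes x: "x \<in> carrier G" and y: "y \<in> carrier G" and z: "z \<in> carrier G"
    and comm: "(inv x \<otimes> y) \<otimes> (inv y \<otimes> z) = (inv y \<otimes> z) \<otimes> (inv x \<otimes> y)"
  shows "commutator G x y \<otimes> commutator G y z = commutator G x z"
proof -
  define a where "a = inv x \<otimes> y"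
  define b where "b = inv y \<otimes> z"
  have a: "a \<in> carrier G" and b: "b \<in> carrier G"
    using x y z by (simp_all add: a_def b_def)
  have c1: "u \<otimes> (inv u \<otimes> w) = w" if "u \<in> carrier G" "w \<in> carrier G" for u w
    using that by (simp flip: m_assoc)
  have c2: "inv u \<otimes> (u \<otimes> w) = w" if "u \<in> carrier G" "w \<in> carrier G" for u w
    using that by (simp flip: m_assoc)
  have ya: "y = x \<otimes> a" unfolding a_def using x y by (simp add: c1)
  have zb: "z = x \<otimes> a \<otimes> b" unfolding b_def ya[symmetric] using y z by (simp add: c1)
  have "a \<otimes> b = b \<otimes> a" using comm by (simp add: a_def b_def)
  then have "inv b \<otimes> inv a = inv a \<otimes> inv b"
    using a b by (simp flip: inv_mult_group)
  then have ab: "inv a \<otimes> (inv b \<otimes> w) = inv b \<otimes> (inv a \<otimes> w)" if "w \<in> carrier G" for w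
    using a b that by (simp flip: m_assoc)
  show ?thesis
    unfolding commutator_def ya zb
    using x a b by (simp add: m_assoc inv_mult_group c1 c2 ab)
qed

lemma simplicial_map_comm:
  fixes G (structure)
  assumes "group G"
  shows "simplicial_map (AfCom G) (nerve (commutator_subgroup G)) (comm_simp G)"
proof -
  interpret group G by fact
  have m: "mult (commutator_subgroup G) = mult G" "one (commutator_subgroup G) = one G"
    "carrier (commutator_subgroup G) = derived G (carrier G)"
    by (simp_all add: commutator_subgroup_def)
  have l: "length (comm_simp G n gs) = n" for n gs by (simp add: comm_simp_def)
  have nt: "k < n \<Longrightarrow> comm_simp G n gs ! k = commutator G (gs ! k) (gs ! Suc k)" for n gs k
    by (simp add: comm_simp_def)
  have cm: "commutator G (gs ! j) (gs ! Suc j) \<otimes> commutator G (gs ! Suc j) (gs ! Suc (Suc j)) = commutator G (gs ! j) (gs ! Suc (Suc j))"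
    if "gs \<in> simplices (AfCom G) (Suc n)" "Suc j \<le> n" for gs n j
    using that by (intro commutator_mult) (auto simp: simplices_AfCom affinely_commutative_def)
  have cx: "commutator G x x = \<one>" if "x \<in> carrier G" for x
    using that by (simp add: commutator_def m_assoc)
  show ?thesis unfolding simplicial_map_def
    apply (intro conjI)
    subgoal by (auto simp: simplices_nerve simplices_AfCom m l nt intro!: commutator_in_derived)
    subgoal using cm by (intro allI ballI impI nth_equalityI; auto simp: simplices_AfCom l nt m length_face_nerve face_nerve_nth face_AfCom_nth)
    subgoal using cx by (intro allI ballI impI nth_equalityI; auto simp: simplices_AfCom l nt m length_degen_nerve degen_nerve_nth degen_AfCom_nth)
    done
qed


section \<open>The spaces and the map on fundamental groups\<close>

definition E_com :: "('a, 'b) monoid_scheme \<Rightarrow> 'a list cell_pt set topology" where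
  "E_com G = realization (AfCom G)"

definition E_com_base :: "('a, 'b) monoid_scheme \<Rightarrow> 'a list cell_pt set" where
  "E_com_base G = realization_vertex (AfCom G) [\<one>\<^bsub>G\<^esub>]"

definition classifying_space :: "('a, 'b) monoid_scheme \<Rightarrow> 'a list cell_pt set topology" where
  "classifying_space H = realization (nerve H)"

definition classifying_base :: "('a, 'b) monoid_scheme \<Rightarrow> 'a list cell_pt set" where
  "classifying_base H = realization_vertex (nerve H) []"

definition comm_map ::
    "('a, 'b) monoid_scheme \<Rightarrow> 'a list cell_pt set
      \<Rightarrow> 'a list cell_pt set" where
  "comm_map G = realization_map (nerve (commutator_subgroup G)) (comm_simp G)"

abbreviation pi1_E_com :: "('a, 'b) monoid_scheme \<Rightarrow> _" where
  "pi1_E_com G \<equiv> fundamental_group (E_com G) (E_com_base G)"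

abbreviation pi1_B :: "('a, 'b) monoid_scheme \<Rightarrow> _" where
  "pi1_B H \<equiv> fundamental_group (classifying_space H) (classifying_base H)"

definition comm_star ::
    "('a, 'b) monoid_scheme \<Rightarrow> (real \<Rightarrow> 'a list cell_pt set) set
      \<Rightarrow> (real \<Rightarrow> 'a list cell_pt set) set" where
  "comm_star G =
    induced_map (classifying_space (commutator_subgroup G)) (comm_map G (E_com_base G)) (comm_map G)"

definition edge_loop_class ::
    "('a, 'b) monoid_scheme \<Rightarrow> 'a \<Rightarrow> (real \<Rightarrow> 'a list cell_pt set) set" where
  "edge_loop_class H x = loop_class (classifying_space H) (classifying_base H) (edge_path (nerve H) [x])"

text \<open>The standard identification of the fundamental group of \<^term>\<open>classifying_space H\<close> with \<open>H\<close>.\<close>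

definition pi1_B_identification ::
    "('a, 'b) monoid_scheme \<Rightarrow> (real \<Rightarrow> 'a list cell_pt set) set \<Rightarrow> 'a" where
  "pi1_B_identification H = inv_into (carrier H) (edge_loop_class H)"

end

theory Submission
  imports Defs "HOL-Analysis.Abstract_Topological_Spaces"
begin

text \<open>Surjectivity of the map on fundamental groups comes from explicit loops. Any two elements \<open>x\<close> and \<open>y\<close>
  of \<open>G\<close> span an edge of the simplicial set of affinely commutative tuples, because a single quotient
  commutes with itself. The triangle of edges through \<open>1\<close>, \<open>x\<close> and \<open>y\<close> is therefore a loop, and the
  commutator map sends it to the concatenation of the loops given by \<open>[1, x] = 1\<close>, \<open>[x, y]\<close> and
  \<open>[y, 1] = 1\<close>. So the image contains all commutators (\<open>commutator_in_image\<close>), and, being closed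
  under products, it contains the group that they generate (\<open>derived_in_image\<close>). If the fundamental
  group of the source is trivial, then so is the commutator subgroup. Conversely, for abelian \<open>G\<close> every
  tuple is affinely commutative, and the simplicial set of all tuples has a contractible realization
  (\<open>contractible_realization_tuples\<close>): append a fixed vertex and contract along the cone.

  This presupposes that \<open>x\<close> corresponds to the loop along the 1-simplex \<open>x\<close> under an isomorphism from a
  group \<open>H\<close> to the fundamental group of its classifying space (\<open>edge_loop_class_iso\<close>), which is shown by
  covering space theory. The realization of all tuples in \<open>H\<close> is contractible, \<open>H\<close> acts on it by left
  translation, and taking consecutive quotients identifies the orbit space with the classifying space.
  Paths and homotopies lift along the quotient by a covering space action (\<open>lift_rectangle\<close>,
  \<open>path_homotopic_lift_endpoints\<close>), and in a contractible space two paths with the same endpoints are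
  homotopic (\<open>contractible_path_homotopic\<close>); the isomorphism follows as usual.

  That the action is a covering space action (\<open>translation_wandering\<close>) is less evident, as the cells of a
  simplicial set may be degenerate or glued to themselves. A point of the realization is
  encoded by a step function from the unit interval to \<open>H\<close>, in which the entries of the tuple are the
  values and the barycentric coordinates are the lengths of the steps. The length of the set where two step
  functions agree depends continuously on each of the two points. A step function and a proper translate
  of it agree nowhere, so that at most one of them agrees with a given step function on more than half
  of the interval. Hence the points whose step function agrees with that of \<open>e\<close> on more than half of
  the interval form a neighbourhood of \<open>e\<close> which is disjoint from its proper translates.\<close>

section \<open>Maps out of a geometric realization\<close>

abbreviation simplex_top :: "nat \<Rightarrow> (nat \<Rightarrow> real) topology" where
  "simplex_top n \<equiv> subtopology (powertop_real UNIV) (standard_simplex n)"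

lemma mem_topspace_cells:
  "((n, x), t) \<in> topspace (cells X) \<longleftrightarrow> x \<in> simplices X n \<and> t \<in> standard_simplex n"
  by (auto simp: cells_def)

lemma openin_cells:
  "openin (cells X) U \<longleftrightarrow> U \<subseteq> topspace (cells X) \<and>
    (\<forall>n. \<forall>x \<in> simplices X n. openin (simplex_top n) {t. ((n, x), t) \<in> U})"
  unfolding cells_def openin_sum_topology topspace_sum_topology
  by (intro conj_cong refl) auto

lemma simplical_degen_in_standard_simplex:
  assumes "t \<in> standard_simplex (Suc n)" "i \<le> n"
  shows "simplical_degen i t \<in> standard_simplex n"
proof -
  have t: "\<And>j. 0 \<le> t j" "\<And>j. j > Suc n \<Longrightarrow> t j = 0" "sum t {..Suc n} = 1"
    using assms by (auto simp: standard_simplex_def)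
  have "sum t {..Suc n} = sum t {..<i} + t i + t (Suc i) + sum t {Suc (Suc i)..Suc n}"
  proof -
    have "{..Suc n} = {..<i} \<union> {i} \<union> {Suc i} \<union> {Suc (Suc i)..Suc n}"
      using assms(2) by auto
    then show ?thesis
      by (simp only:) (subst sum.union_disjoint; force)+
  qed
  moreover have "sum (simplical_degen i t) {..n}
      = sum t {..<i} + (t i + t (Suc i)) + sum t {Suc (Suc i)..Suc n}"
  proof -
    have "{..n} = {..<i} \<union> {i} \<union> {Suc i..n}" using assms(2) by auto
    then have "sum (simplical_degen i t) {..n} = sum (simplical_degen i t) {..<i}
        + simplical_degen i t i + sum (simplical_degen i t) {Suc i..n}"
      by (simp only:) (subst sum.union_disjoint; force)+
    moreover have "sum (simplical_degen i t) {Suc i..n} = sum t {Suc (Suc i)..Suc n}"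
      unfolding sum.shift_bounds_cl_Suc_ivl by (intro sum.cong) (auto simp: simplical_degen_def)
    moreover have "sum (simplical_degen i t) {..<i} = sum t {..<i}"
      by (intro sum.cong) (auto simp: simplical_degen_def)
    ultimately show ?thesis by (simp add: simplical_degen_def)
  qed
  ultimately have s: "sum (simplical_degen i t) {..n} = 1" using t by simp
  have nn: "0 \<le> simplical_degen i t j" for j using t(1) by (simp add: simplical_degen_def)
  have z: "simplical_degen i t j = 0" if "j > n" for j
    using that assms(2) t(2) by (simp add: simplical_degen_def)
  have "simplical_degen i t j \<le> 1" for j
  proof (cases "j \<le> n")
    case True
    then show ?thesis using s nn by (metis atMost_iff finite_atMost member_le_sum)
  qed (simp add: z)
  then show ?thesis using s nn z by (simp add: standard_simplex_def)
qed

lemma simplicial_set_closed: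
  assumes "simplicial_set X"
  shows "x \<in> simplices X (Suc n) \<Longrightarrow> i \<le> Suc n \<Longrightarrow> face X (Suc n) i x \<in> simplices X n"
    and "x \<in> simplices X n \<Longrightarrow> i \<le> n \<Longrightarrow> degen X n i x \<in> simplices X (Suc n)"
  using assms unfolding simplicial_set_def by (elim conjE, simp add: Pi_iff)+

lemma glue_cells:
  assumes "simplicial_set X"
  shows "glue X \<subseteq> topspace (cells X) \<times> topspace (cells X)"
proof -
  have "simplical_face i t \<in> standard_simplex (Suc n)"
    if "i \<le> Suc n" "t \<in> standard_simplex n" for i n and t :: "nat \<Rightarrow> real"
    using simplical_face_in_standard_simplex[of "Suc n" i t] that by simp
  then show ?thesis
    unfolding glue_def
    by (auto simp: mem_topspace_cells simplicial_set_closed[OF assms] simplical_degen_in_standard_simplex)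
qed

lemma glue_face:
  assumes "x \<in> simplices X (Suc n)" "i \<le> Suc n" "t \<in> standard_simplex n"
  shows "(((n, face X (Suc n) i x), t), ((Suc n, x), simplical_face i t)) \<in> glue X"
  unfolding glue_def using assms
  by (intro UnI1 CollectI exI[of _ n] exI[of _ i] exI[of _ x] exI[of _ t]) simp

lemma glue_degen:
  assumes "x \<in> simplices X n" "i \<le> n" "t \<in> standard_simplex (Suc n)"
  shows "(((Suc n, degen X n i x), t), ((n, x), simplical_degen i t)) \<in> glue X"
  unfolding glue_def using assms
  by (intro UnI2 CollectI exI[of _ n] exI[of _ i] exI[of _ x] exI[of _ t]) simp

lemma equiv_realization_rel: "equiv (topspace (cells X)) (realization_rel X)"
proof (rule equivI)
  let ?R = "(glue X \<union> (glue X)\<inverse>)\<^sup>*"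
  show "realization_rel X \<subseteq> topspace (cells X) \<times> topspace (cells X)"
    by (auto simp: realization_rel_def)
  show "refl_on (topspace (cells X)) (realization_rel X)"
    by (auto simp: refl_on_def realization_rel_def)
  have "sym ?R" by (intro sym_rtrancl sym_Un_converse)
  then show "sym (realization_rel X)"
    by (auto simp: sym_def realization_rel_def)
  show "trans (realization_rel X)"
    unfolding trans_def realization_rel_def by (blast intro: rtrancl_trans)
qed

text \<open>The functions of a simplex and of a point in its copy of the standard simplex that factor through the
  realization.\<close>

definition glue_invariant :: "'a sset \<Rightarrow> (nat \<Rightarrow> 'a \<Rightarrow> (nat \<Rightarrow> real) \<Rightarrow> 'c) \<Rightarrow> bool" where
  "glue_invariant X F \<longleftrightarrow>
    (\<forall>n i x t. x \<in> simplices X (Suc n) \<longrightarrow> i \<le> Suc n \<longrightarrow> t \<in> standard_simplex n \<longrightarrow>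
       F n (face X (Suc n) i x) t = F (Suc n) x (simplical_face i t)) \<and>
    (\<forall>n i x t. x \<in> simplices X n \<longrightarrow> i \<le> n \<longrightarrow> t \<in> standard_simplex (Suc n) \<longrightarrow>
       F (Suc n) (degen X n i x) t = F n x (simplical_degen i t))"

lemma glue_invariant_realization_rel:
  assumes "glue_invariant X F" "(((n, x), t), ((m, y), u)) \<in> realization_rel X"
  shows "F n x t = F m y u"
proof -
  define f where "f = (\<lambda>((n, x), t). F n x t)"
  have g: "f p = f q" if "(p, q) \<in> glue X" for p q
    using that assms(1) by (auto simp: glue_def glue_invariant_def f_def)
  have "(((n, x), t), ((m, y), u)) \<in> (glue X \<union> (glue X)\<inverse>)\<^sup>*"
    using assms(2) by (simp add: realization_rel_def)
  then have "f ((n, x), t) = f ((m, y), u)"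
    by (induction rule: rtrancl_induct) (auto dest: g)
  then show ?thesis by (simp add: f_def)
qed

lemma realization_pt_eq_iff:
  assumes "x \<in> simplices X n" "t \<in> standard_simplex n" "y \<in> simplices X m" "u \<in> standard_simplex m"
  shows "realization_pt X n x t = realization_pt X m y u
    \<longleftrightarrow> (((n, x), t), ((m, y), u)) \<in> realization_rel X"
  unfolding realization_pt_def
  using assms by (intro eq_equiv_class_iff[OF equiv_realization_rel]) (auto simp: mem_topspace_cells)

lemma glue_invariant_eq:
  assumes "glue_invariant X F" "realization_pt X n x t = realization_pt X m y u"
    "x \<in> simplices X n" "t \<in> standard_simplex n" "y \<in> simplices X m" "u \<in> standard_simplex m"
  shows "F n x t = F m y u"
  using assms by (simp add: realization_pt_eq_iff glue_invariant_realization_rel)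

lemma glue_invariant_realization_pt:
  assumes "simplicial_set X"
  shows "glue_invariant X (realization_pt X)"
proof -
  have "realization_pt X n x t = realization_pt X m y u"
    if g: "(((n, x), t), ((m, y), u)) \<in> glue X" for n x t m y u
  proof -
    have "(((n, x), t), ((m, y), u)) \<in> realization_rel X"
      using g glue_cells[OF assms] unfolding realization_rel_def by blast
    then show ?thesis
      unfolding realization_pt_def by (rule equiv_class_eq[OF equiv_realization_rel])
  qed
  then show ?thesis
    unfolding glue_invariant_def by (intro conjI allI impI) (simp_all add: glue_face glue_degen)
qed

lemma realization_pt_face:
  "simplicial_set X \<Longrightarrow> x \<in> simplices X (Suc n) \<Longrightarrow> i \<le> Suc n \<Longrightarrow> t \<in> standard_simplex n \<Longrightarrow>
    realization_pt X n (face X (Suc n) i x) t = realization_pt X (Suc n) x (simplical_face i t)"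
  using glue_invariant_realization_pt[of X] unfolding glue_invariant_def by blast

lemma realization_pt_degen:
  "simplicial_set X \<Longrightarrow> x \<in> simplices X n \<Longrightarrow> i \<le> n \<Longrightarrow> t \<in> standard_simplex (Suc n) \<Longrightarrow>
    realization_pt X (Suc n) (degen X n i x) t = realization_pt X n x (simplical_degen i t)"
  using glue_invariant_realization_pt[of X] unfolding glue_invariant_def by blast

lemma topspace_realization:
  "topspace (realization X) = {realization_pt X n x t | n x t. x \<in> simplices X n \<and> t \<in> standard_simplex n}"
proof
  show "topspace (realization X)
      \<subseteq> {realization_pt X n x t | n x t. x \<in> simplices X n \<and> t \<in> standard_simplex n}"
    by (auto simp: realization_def quotient_def realization_pt_def cells_def) blast
  show "{realization_pt X n x t | n x t. x \<in> simplices X n \<and> t \<in> standard_simplex n}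
      \<subseteq> topspace (realization X)"
    unfolding realization_def topspace_quotient_topology realization_pt_def
    by (auto intro!: quotientI simp: mem_topspace_cells)
qed

lemma realization_pt_in_topspace:
  "x \<in> simplices X n \<Longrightarrow> t \<in> standard_simplex n \<Longrightarrow> realization_pt X n x t \<in> topspace (realization X)"
  by (auto simp: topspace_realization)

lemma realization_cases:
  assumes "p \<in> topspace (realization X)"
  obtains n x t where "x \<in> simplices X n" "t \<in> standard_simplex n" "p = realization_pt X n x t"
  using assms by (auto simp: topspace_realization)

text \<open>The common value of \<open>f\<close> on the equivalence class \<open>A\<close>.\<close>

definition descend :: "('a cell_pt \<Rightarrow> 'c) \<Rightarrow> 'a cell_pt set \<Rightarrow> 'c" where
  "descend f A = the_elem (f ` A)"

lemma descend_realization_pt: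
  assumes "glue_invariant X F" "x \<in> simplices X n" "t \<in> standard_simplex n"
  shows "descend (\<lambda>((n, x), t). F n x t) (realization_pt X n x t) = F n x t"
proof -
  let ?f = "\<lambda>((n, x), t). F n x t"
  have "((n, x), t) \<in> realization_pt X n x t"
    using assms by (simp add: realization_pt_def realization_rel_def mem_topspace_cells)
  moreover have "?f c = ?f ((n, x), t)" if "c \<in> realization_pt X n x t" for c
  proof -
    obtain m y u where c: "c = ((m, y), u)" by (metis prod.exhaust)
    show ?thesis
      using glue_invariant_realization_rel[OF assms(1), of n x t m y u] that
      by (simp add: c realization_pt_def)
  qed
  ultimately have "the_elem (?f ` realization_pt X n x t) = ?f ((n, x), t)"
    by (intro the_elem_image_unique) blast+
  then show ?thesis by (simp add: descend_def)
qed

text \<open>Openness in the product is checked in each summand, because the copies of the simplices are open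
  in the disjoint union.\<close>

lemma continuous_map_prod_cells:
  assumes "\<And>n x. x \<in> simplices X n \<Longrightarrow>
    continuous_map (prod_topology Z (simplex_top n)) W (\<lambda>(z, t). F (z, ((n, x), t)))"
  shows "continuous_map (prod_topology Z (cells X)) W F"
  unfolding continuous_map_def
proof (intro conjI allI impI)
  show "F \<in> topspace (prod_topology Z (cells X)) \<rightarrow> topspace W"
  proof
    fix p assume p: "p \<in> topspace (prod_topology Z (cells X))"
    obtain z n x t where pe: "p = (z, ((n, x), t))" by (metis prod.exhaust)
    with p have "x \<in> simplices X n" "z \<in> topspace Z" "t \<in> standard_simplex n"
      by (auto simp: mem_topspace_cells)
    with continuous_map_funspace[OF assms[of x n]] show "F p \<in> topspace W"
      by (auto simp: pe Pi_iff)
  qed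
next
  fix V assume V: "openin W V"
  show "openin (prod_topology Z (cells X)) {p \<in> topspace (prod_topology Z (cells X)). F p \<in> V}"
  proof (subst openin_subopen, intro ballI)
    fix p assume p: "p \<in> {p \<in> topspace (prod_topology Z (cells X)). F p \<in> V}"
    obtain z n x t where pe: "p = (z, ((n, x), t))" by (metis prod.exhaust)
    with p have x: "x \<in> simplices X n" and zt: "z \<in> topspace Z" "t \<in> standard_simplex n"
      and FV: "F (z, ((n, x), t)) \<in> V"
      by (auto simp: mem_topspace_cells)
    define Q where "Q = {q \<in> topspace (prod_topology Z (simplex_top n)).
        (\<lambda>(z, t). F (z, ((n, x), t))) q \<in> V}"
    have "openin (prod_topology Z (simplex_top n)) Q"
      unfolding Q_def using assms[OF x] V by (rule openin_continuous_map_preimage)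
    moreover have "(z, t) \<in> Q"
      using zt FV by (simp add: Q_def)
    ultimately obtain A B where AB: "openin Z A" "openin (simplex_top n) B" "z \<in> A" "t \<in> B"
      and sub: "A \<times> B \<subseteq> Q"
      by (metis openin_prod_topology_alt)
    have "openin (cells X) ({(n, x)} \<times> B)"
      unfolding openin_cells
    proof (intro conjI allI ballI)
      show "{(n, x)} \<times> B \<subseteq> topspace (cells X)"
        using x openin_subset[OF AB(2)] by (auto simp: mem_topspace_cells)
      fix m y
      have "{u. ((m, y), u) \<in> {(n, x)} \<times> B} = (if m = n \<and> y = x then B else {})" by auto
      then show "openin (simplex_top m) {u. ((m, y), u) \<in> {(n, x)} \<times> B}"
        using AB(2) by (simp only: split: if_split) simp
    qed
    then have "openin (prod_topology Z (cells X)) (A \<times> ({(n, x)} \<times> B))"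
      using AB(1) by (simp add: openin_prod_Times_iff)
    moreover have "A \<times> ({(n, x)} \<times> B) \<subseteq> {p \<in> topspace (prod_topology Z (cells X)). F p \<in> V}"
      using sub x by (auto simp: mem_topspace_cells Q_def)
    ultimately show "\<exists>T. openin (prod_topology Z (cells X)) T \<and> p \<in> T
        \<and> T \<subseteq> {p \<in> topspace (prod_topology Z (cells X)). F p \<in> V}"
      using AB by (intro exI[of _ "A \<times> ({(n, x)} \<times> B)"]) (simp add: pe)
  qed
qed

lemma quotient_map_cells:
  "quotient_map (cells X) (realization X) (\<lambda>c. realization_rel X `` {c})"
  unfolding realization_def by (rule quotient_map_quotient_topology)

text \<open>Multiplying a quotient map with a locally compact Hausdorff space gives a quotient map; hence a
  homotopy on a realization may be given simplex by simplex.\<close>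

lemma continuous_map_prod_realization:
  assumes "locally_compact_space Z" "Hausdorff_space Z"
    and "\<And>n x. x \<in> simplices X n \<Longrightarrow>
      continuous_map (prod_topology Z (simplex_top n)) W (\<lambda>(z, t). G (z, realization_pt X n x t))"
  shows "continuous_map (prod_topology Z (realization X)) W G"
proof (rule continuous_compose_quotient_map)
  show "quotient_map (prod_topology Z (cells X)) (prod_topology Z (realization X))
      (\<lambda>(z, c). (z, realization_rel X `` {c}))"
    using assms(1,2) quotient_map_cells by (intro quotient_map_prod_right) auto
  show "continuous_map (prod_topology Z (cells X)) W (G \<circ> (\<lambda>(z, c). (z, realization_rel X `` {c})))"
    using assms(3) by (intro continuous_map_prod_cells) (simp add: realization_pt_def case_prod_unfold)
qed

lemma continuous_map_cells:
  assumes "\<And>n x. x \<in> simplices X n \<Longrightarrow> continuous_map (simplex_top n) W (\<lambda>t. F ((n, x), t))"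
  shows "continuous_map (cells X) W F"
  unfolding continuous_map_def
proof (intro conjI allI impI)
  show "F \<in> topspace (cells X) \<rightarrow> topspace W"
    using assms by (auto simp: mem_topspace_cells continuous_map_def Pi_iff)
  fix V assume V: "openin W V"
  have "openin (simplex_top n) {t. ((n, x), t) \<in> {c \<in> topspace (cells X). F c \<in> V}}"
    if "x \<in> simplices X n" for n x
    using openin_continuous_map_preimage[OF assms[OF that] V] that by (simp add: mem_topspace_cells)
  then show "openin (cells X) {c \<in> topspace (cells X). F c \<in> V}"
    by (auto simp: openin_cells)
qed

lemma continuous_map_realization:
  assumes "\<And>n x. x \<in> simplices X n \<Longrightarrow>
      continuous_map (simplex_top n) W (\<lambda>t. G (realization_pt X n x t))"
  shows "continuous_map (realization X) W G"
proof (rule continuous_compose_quotient_map[OF quotient_map_cells])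
  show "continuous_map (cells X) W (G \<circ> (\<lambda>c. realization_rel X `` {c}))"
    using assms by (intro continuous_map_cells) (simp add: realization_pt_def)
qed

lemma continuous_map_Pair_cells:
  "x \<in> simplices X n \<Longrightarrow> continuous_map (simplex_top n) (cells X) (Pair (n, x))"
  unfolding cells_def
  using continuous_map_component_injection[of "(n, x)" "SIGMA n:UNIV. simplices X n" "\<lambda>(n, x). simplex_top n"]
  by simp

lemma continuous_map_realization_pt:
  assumes "x \<in> simplices X n"
  shows "continuous_map (simplex_top n) (realization X) (realization_pt X n x)"
proof -
  have "continuous_map (simplex_top n) (realization X) ((\<lambda>c. realization_rel X `` {c}) \<circ> Pair (n, x))"
    by (rule continuous_map_compose[OF continuous_map_Pair_cells[OF assms]
          quotient_imp_continuous_map[OF quotient_map_cells]])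
  then show ?thesis by (simp add: o_def realization_pt_def[abs_def])
qed

section \<open>Simplicial maps\<close>

lemma simplicial_map_closed:
  "simplicial_map X Y f \<Longrightarrow> x \<in> simplices X n \<Longrightarrow> f n x \<in> simplices Y n"
  unfolding simplicial_map_def by blast

lemma simplicial_map_face:
  "simplicial_map X Y f \<Longrightarrow> x \<in> simplices X (Suc n) \<Longrightarrow> i \<le> Suc n \<Longrightarrow>
    f n (face X (Suc n) i x) = face Y (Suc n) i (f (Suc n) x)"
  by (simp add: simplicial_map_def)

lemma simplicial_map_degen:
  "simplicial_map X Y f \<Longrightarrow> x \<in> simplices X n \<Longrightarrow> i \<le> n \<Longrightarrow>
    f (Suc n) (degen X n i x) = degen Y n i (f n x)"
  by (simp add: simplicial_map_def)

lemma glue_invariant_simplicial_map: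
  assumes "simplicial_map X Y f" "glue_invariant Y F"
  shows "glue_invariant X (\<lambda>n x. F n (f n x))"
  using assms simplicial_map_closed[OF assms(1)]
  unfolding glue_invariant_def simplicial_map_def by auto

lemma realization_map_pt:
  assumes "simplicial_set Y" "simplicial_map X Y f" "x \<in> simplices X n" "t \<in> standard_simplex n"
  shows "realization_map Y f (realization_pt X n x t) = realization_pt Y n (f n x) t"
proof -
  have ne: "((n, x), t) \<in> realization_pt X n x t"
    using assms by (simp add: realization_pt_def realization_rel_def mem_topspace_cells)
  have "(\<lambda>((n, x), t). realization_pt Y n (f n x) t) c = realization_pt Y n (f n x) t"
    if "c \<in> realization_pt X n x t" for c
  proof -
    obtain m y u where c: "c = ((m, y), u)" by (metis prod.exhaust)
    show ?thesis
      using glue_invariant_realization_rel[OF glue_invariant_simplicial_map[OF assms(2)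
        glue_invariant_realization_pt[OF assms(1)]], of n x t m y u] that
      by (simp add: c realization_pt_def[of X])
  qed
  moreover have "realization_pt X n x t \<noteq> {}" using ne by (metis empty_iff)
  ultimately show ?thesis
    unfolding realization_map_def by (intro SUP_eq_const)
qed

lemma continuous_map_realization_map:
  assumes "simplicial_set Y" "simplicial_map X Y f"
  shows "continuous_map (realization X) (realization Y) (realization_map Y f)"
proof (rule continuous_map_realization)
  fix n x assume x: "x \<in> simplices X n"
  show "continuous_map (simplex_top n) (realization Y) (\<lambda>t. realization_map Y f (realization_pt X n x t))"
    by (rule continuous_map_eq[OF continuous_map_realization_pt[OF simplicial_map_closed[OF assms(2) x]]])
      (simp add: realization_map_pt[OF assms x])
qed

text \<open>A simplicial map carries each cell onto a cell without changing the barycentric coordinates, so that it is an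
  open map between the disjoint unions of cells. Composing with the quotient map onto the target
  realization shows that the map of realizations is a quotient map.\<close>

lemma quotient_map_realization_map:
  assumes "simplicial_set Y" "simplicial_map X Y f"
    and surj: "\<And>n. f n ` simplices X n = simplices Y n"
  shows "quotient_map (realization X) (realization Y) (realization_map Y f)"
proof (rule quotient_map_from_composition[where X = "cells X" and f = "\<lambda>c. realization_rel X `` {c}"])
  let ?c = "\<lambda>((n, x), t). ((n, f n x), t)"
  show "continuous_map (cells X) (realization X) (\<lambda>c. realization_rel X `` {c})"
    by (rule quotient_imp_continuous_map[OF quotient_map_cells])
  show "continuous_map (realization X) (realization Y) (realization_map Y f)"
    by (rule continuous_map_realization_map[OF assms(1,2)])
  have "quotient_map (cells X) (cells Y) ?c"
  proof (rule continuous_open_imp_quotient_map)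
    show "continuous_map (cells X) (cells Y) ?c"
    proof (rule continuous_map_cells)
      fix n x assume "x \<in> simplices X n"
      then have "f n x \<in> simplices Y n" by (rule simplicial_map_closed[OF assms(2)])
      then show "continuous_map (simplex_top n) (cells Y) (\<lambda>t. ?c ((n, x), t))"
        by (simp add: continuous_map_Pair_cells)
    qed
    show "?c ` topspace (cells X) = topspace (cells Y)"
    proof
      show "?c ` topspace (cells X) \<subseteq> topspace (cells Y)"
        using simplicial_map_closed[OF assms(2)] by (auto simp: mem_topspace_cells)
      show "topspace (cells Y) \<subseteq> ?c ` topspace (cells X)"
      proof
        fix c assume c: "c \<in> topspace (cells Y)"
        obtain n y t where ce: "c = ((n, y), t)" by (metis prod.exhaust)
        with c have "y \<in> f n ` simplices X n" and t: "t \<in> standard_simplex n"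
          by (auto simp: mem_topspace_cells surj)
        then obtain x where "x \<in> simplices X n" "y = f n x" by blast
        with t show "c \<in> ?c ` topspace (cells X)"
          by (intro image_eqI[of _ _ "((n, x), t)"]) (simp_all add: ce mem_topspace_cells)
      qed
    qed
    show "open_map (cells X) (cells Y) ?c"
      unfolding open_map_def
    proof (intro allI impI)
      fix U assume U: "openin (cells X) U"
      have image_iff: "((n, y), t) \<in> ?c ` U \<longleftrightarrow> (\<exists>x \<in> simplices X n. f n x = y \<and> ((n, x), t) \<in> U)" for n y t
      proof
        assume "((n, y), t) \<in> ?c ` U"
        then obtain x where x: "((n, x), t) \<in> U" "f n x = y" by auto
        then have "x \<in> simplices X n"
          using subsetD[OF openin_subset[OF U] x(1)] by (simp add: mem_topspace_cells)
        with x show "\<exists>x \<in> simplices X n. f n x = y \<and> ((n, x), t) \<in> U" by blast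
      next
        assume "\<exists>x \<in> simplices X n. f n x = y \<and> ((n, x), t) \<in> U"
        then obtain x where "((n, x), t) \<in> U" "f n x = y" by blast
        then show "((n, y), t) \<in> ?c ` U"
          by (intro image_eqI[of _ _ "((n, x), t)"]) simp_all
      qed
      have "openin (simplex_top n) {t. ((n, y), t) \<in> ?c ` U}" for n y
      proof -
        have "{t. ((n, y), t) \<in> ?c ` U} = \<Union> ((\<lambda>x. {t. ((n, x), t) \<in> U}) ` {x \<in> simplices X n. f n x = y})"
          by (auto simp only: image_iff)
        moreover have "openin (simplex_top n) {t. ((n, x), t) \<in> U}" if "x \<in> simplices X n" for x
          using U that by (simp add: openin_cells)
        ultimately show ?thesis by (simp only:) (rule openin_Union, blast)
      qed
      moreover have "?c ` U \<subseteq> topspace (cells Y)"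
      proof
        fix c assume "c \<in> ?c ` U"
        then obtain n x t where x: "((n, x), t) \<in> U" "c = ((n, f n x), t)" by auto
        then show "c \<in> topspace (cells Y)"
          using subsetD[OF openin_subset[OF U] x(1)] simplicial_map_closed[OF assms(2)]
          by (simp add: mem_topspace_cells)
      qed
      ultimately show "openin (cells Y) (?c ` U)"
        by (simp add: openin_cells)
    qed
  qed
  then have "quotient_map (cells X) (realization Y) ((\<lambda>c. realization_rel Y `` {c}) \<circ> ?c)"
    by (rule quotient_map_compose[OF _ quotient_map_cells])
  then show "quotient_map (cells X) (realization Y) (realization_map Y f \<circ> (\<lambda>c. realization_rel X `` {c}))"
  proof (rule quotient_map_eq)
    fix c assume c: "c \<in> topspace (cells X)"
    obtain n x t where ce: "c = ((n, x), t)" by (metis prod.exhaust)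
    show "((\<lambda>c. realization_rel Y `` {c}) \<circ> ?c) c = (realization_map Y f \<circ> (\<lambda>c. realization_rel X `` {c})) c"
      using c realization_map_pt[OF assms(1,2), of x n t]
      by (simp add: ce mem_topspace_cells realization_pt_def[symmetric])
  qed
qed

section \<open>Path homotopy and the fundamental group\<close>

definition path_homotopic :: "'a topology \<Rightarrow> 'a \<Rightarrow> 'a \<Rightarrow> (real \<Rightarrow> 'a) \<Rightarrow> (real \<Rightarrow> 'a) \<Rightarrow> bool" where
  "path_homotopic X a b = homotopic_with (\<lambda>r. r 0 = a \<and> r 1 = b) (top_of_set {0..1}) X"

lemma path_homotopic_iff:
  "path_homotopic X a b p q \<longleftrightarrow>
    (\<exists>h::real \<times> real \<Rightarrow> 'a. continuous_map (top_of_set ({0..1} \<times> {0..1})) X h \<and>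
      (\<forall>s\<in>{0..1}. h (0, s) = p s \<and> h (1, s) = q s) \<and> (\<forall>t\<in>{0..1}. h (t, 0) = a \<and> h (t, 1) = b))"
  unfolding path_homotopic_def by (subst homotopic_with) (simp, simp, blast)

lemma path_homotopicI:
  fixes h :: "real \<times> real \<Rightarrow> 'a"
  assumes "continuous_map (top_of_set ({0..1} \<times> {0..1})) X h"
    "\<And>s. s \<in> {0..1} \<Longrightarrow> h (0, s) = p s" "\<And>s. s \<in> {0..1} \<Longrightarrow> h (1, s) = q s"
    "\<And>t. t \<in> {0..1} \<Longrightarrow> h (t, 0) = a" "\<And>t. t \<in> {0..1} \<Longrightarrow> h (t, 1) = b"
  shows "path_homotopic X a b p q"
  unfolding path_homotopic_iff using assms by (intro exI[of _ h]) simp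

lemma path_homotopicE:
  assumes "path_homotopic X a b p q"
  obtains h :: "real \<times> real \<Rightarrow> 'a" where "continuous_map (top_of_set ({0..1} \<times> {0..1})) X h"
    "\<And>s. s \<in> {0..1} \<Longrightarrow> h (0, s) = p s" "\<And>s. s \<in> {0..1} \<Longrightarrow> h (1, s) = q s"
    "\<And>t. t \<in> {0..1} \<Longrightarrow> h (t, 0) = a" "\<And>t. t \<in> {0..1} \<Longrightarrow> h (t, 1) = b"
proof -
  obtain h :: "real \<times> real \<Rightarrow> 'a" where "continuous_map (top_of_set ({0..1} \<times> {0..1})) X h"
    "\<forall>s\<in>{0..1}. h (0, s) = p s \<and> h (1, s) = q s" "\<forall>t\<in>{0..1}. h (t, 0) = a \<and> h (t, 1) = b"
    using assms unfolding path_homotopic_iff by blast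
  then show thesis by (intro that[of h]) simp_all
qed

lemma path_homotopic_sym: "path_homotopic X a b p q \<Longrightarrow> path_homotopic X a b q p"
  unfolding path_homotopic_def by (rule homotopic_with_symD)

lemma path_homotopic_trans [trans]:
  "path_homotopic X a b p q \<Longrightarrow> path_homotopic X a b q r \<Longrightarrow> path_homotopic X a b p r"
  unfolding path_homotopic_def by (rule homotopic_with_trans)

lemma path_homotopic_refl:
  "path_homotopic X a b p p \<longleftrightarrow> pathin X p \<and> p 0 = a \<and> p 1 = b"
  unfolding path_homotopic_def pathin_def by simp

lemma path_homotopic_imp_paths:
  assumes "path_homotopic X a b p q"
  shows "pathin X p" "p 0 = a" "p 1 = b" "pathin X q" "q 0 = a" "q 1 = b"
  using homotopic_with_imp_continuous_maps[OF assms[unfolded path_homotopic_def]]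
    homotopic_with_imp_property[OF assms[unfolded path_homotopic_def]]
  by (auto simp: pathin_def)

lemma path_homotopic_compose:
  assumes "path_homotopic X a b p q" "continuous_map X Y f"
  shows "path_homotopic Y (f a) (f b) (f \<circ> p) (f \<circ> q)"
  using assms unfolding path_homotopic_def
  by (rule homotopic_with_compose_continuous_map_left) auto

lemma path_homotopic_eq_on:
  assumes "pathin X p" "p 0 = a" "p 1 = b" "\<And>s. s \<in> {0..1} \<Longrightarrow> q s = p s"
  shows "path_homotopic X a b p q"
  unfolding path_homotopic_def
  using assms by (intro homotopic_with_equal) (auto simp: pathin_def)

lemma path_homotopic_loop_join:
  assumes "path_homotopic X a b p p'" "path_homotopic X b c q q'"
  shows "path_homotopic X a c (loop_join p q) (loop_join p' q')"
proof -
  let ?I = "{0..1} \<times> {0..1} :: (real \<times> real) set"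
  obtain h :: "real \<times> real \<Rightarrow> 'a" where h: "continuous_map (top_of_set ?I) X h"
    "\<And>s. s \<in> {0..1} \<Longrightarrow> h (0, s) = p s" "\<And>s. s \<in> {0..1} \<Longrightarrow> h (1, s) = p' s"
    "\<And>t. t \<in> {0..1} \<Longrightarrow> h (t, 0) = a" "\<And>t. t \<in> {0..1} \<Longrightarrow> h (t, 1) = b"
    by (rule path_homotopicE[OF assms(1)]) blast
  obtain k :: "real \<times> real \<Rightarrow> 'a" where k: "continuous_map (top_of_set ?I) X k"
    "\<And>s. s \<in> {0..1} \<Longrightarrow> k (0, s) = q s" "\<And>s. s \<in> {0..1} \<Longrightarrow> k (1, s) = q' s"
    "\<And>t. t \<in> {0..1} \<Longrightarrow> k (t, 0) = b" "\<And>t. t \<in> {0..1} \<Longrightarrow> k (t, 1) = c"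
    by (rule path_homotopicE[OF assms(2)]) blast
  define l where "l = (\<lambda>z. if snd z \<le> 1/2 then h (fst z, 2 * snd z) else k (fst z, 2 * snd z - 1))"
  have "continuous_map (top_of_set ?I) X l"
    unfolding l_def
  proof (rule continuous_map_cases_le)
    show "continuous_map (top_of_set ?I) euclideanreal snd"
      "continuous_map (top_of_set ?I) euclideanreal (\<lambda>z. 1/2)"
      by (auto intro!: continuous_intros)
    have "continuous_map (top_of_set (?I \<inter> {z \<in> ?I. snd z \<le> 1/2})) (top_of_set ?I)
        (\<lambda>z. (fst z, 2 * snd z))"
      unfolding continuous_map_subtopology_eu by (intro conjI continuous_intros) auto
    from continuous_map_compose[OF this h(1)] show "continuous_map (subtopology (top_of_set ?I) {z \<in> topspace (top_of_set ?I). snd z \<le> 1/2}) X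
        (\<lambda>z. h (fst z, 2 * snd z))"
      by (simp add: subtopology_subtopology o_def)
    have "continuous_map (top_of_set (?I \<inter> {z \<in> ?I. 1/2 \<le> snd z})) (top_of_set ?I)
        (\<lambda>z. (fst z, 2 * snd z - 1))"
      unfolding continuous_map_subtopology_eu by (intro conjI continuous_intros) auto
    from continuous_map_compose[OF this k(1)] show "continuous_map (subtopology (top_of_set ?I) {z \<in> topspace (top_of_set ?I). 1/2 \<le> snd z}) X
        (\<lambda>z. k (fst z, 2 * snd z - 1))"
      by (simp add: subtopology_subtopology o_def)
    show "h (fst z, 2 * snd z) = k (fst z, 2 * snd z - 1)"
      if "z \<in> topspace (top_of_set ?I)" "snd z = 1/2" for z
    proof -
      have "2 * snd z = 1" using that(2) by simp
      then show ?thesis using that(1) h(5) k(4) by auto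
    qed
  qed
  then show ?thesis
    by (rule path_homotopicI) (use h(2-) k(2-) in \<open>auto simp: l_def loop_join_def\<close>)
qed

lemma pathin_loop_join:
  assumes "pathin X p" "pathin X q" "p 1 = q 0"
  shows "pathin X (loop_join p q)" "loop_join p q 0 = p 0" "loop_join p q 1 = q 1"
  using path_homotopic_imp_paths[OF path_homotopic_loop_join[of X "p 0" "q 0" p p "q 1" q q]] assms
  by (auto simp: path_homotopic_refl)

lemma comp_loop_join: "f \<circ> loop_join p q = loop_join (f \<circ> p) (f \<circ> q)"
  by (auto simp: loop_join_def)

subsection \<open>Classes of loops\<close>

lemma mem_loops: "p \<in> loops X b \<longleftrightarrow> path_homotopic X b b p p"
  by (auto simp: loops_def path_homotopic_refl)

lemma mem_loop_class: "q \<in> loop_class X b p \<longleftrightarrow> path_homotopic X b b p q"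
  by (simp add: loop_class_def path_homotopic_def)

lemma loop_class_eq:
  assumes "path_homotopic X b b p q"
  shows "loop_class X b p = loop_class X b q"
proof -
  have "path_homotopic X b b p r \<longleftrightarrow> path_homotopic X b b q r" for r
    using assms by (metis path_homotopic_sym path_homotopic_trans)
  then show ?thesis by (auto simp: mem_loop_class)
qed

lemma loop_class_eq_iff:
  "p \<in> loops X b \<Longrightarrow> loop_class X b p = loop_class X b q \<longleftrightarrow> path_homotopic X b b p q"
  by (metis loop_class_eq mem_loop_class mem_loops path_homotopic_sym path_homotopic_imp_paths path_homotopic_refl)

lemma loop_join_loops: "p \<in> loops X b \<Longrightarrow> q \<in> loops X b \<Longrightarrow> loop_join p q \<in> loops X b"
  unfolding mem_loops by (rule path_homotopic_loop_join)

lemma fundamental_group_carrier: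
  "A \<in> carrier (fundamental_group X b) \<longleftrightarrow> (\<exists>p \<in> loops X b. A = loop_class X b p)"
  by (auto simp: fundamental_group_def)

lemma fundamental_group_mult:
  assumes "p \<in> loops X b" "q \<in> loops X b"
  shows "loop_class X b p \<otimes>\<^bsub>fundamental_group X b\<^esub> loop_class X b q = loop_class X b (loop_join p q)"
proof -
  have "loop_class X b (loop_join p' q') = loop_class X b (loop_join p q)"
    if "p' \<in> loop_class X b p" "q' \<in> loop_class X b q" for p' q'
    using that unfolding mem_loop_class
    by (metis loop_class_eq path_homotopic_loop_join path_homotopic_sym)
  moreover have "p \<in> loop_class X b p" "q \<in> loop_class X b q"
    using assms by (auto simp: mem_loop_class mem_loops)
  ultimately show ?thesis
    unfolding fundamental_group_def monoid.simps by blast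
qed

lemma induced_map_loop_class:
  assumes "continuous_map X Y f" "p \<in> loops X b"
  shows "induced_map Y (f b) f (loop_class X b p) = loop_class Y (f b) (f \<circ> p)"
proof -
  have "loop_class Y (f b) (f \<circ> q) = loop_class Y (f b) (f \<circ> p)" if "q \<in> loop_class X b p" for q
    using that assms(1) unfolding mem_loop_class
    by (metis loop_class_eq path_homotopic_compose)
  moreover have "p \<in> loop_class X b p"
    using assms by (auto simp: mem_loop_class mem_loops)
  ultimately show ?thesis
    unfolding induced_map_def by blast
qed

lemma comp_loops: "continuous_map X Y f \<Longrightarrow> p \<in> loops X b \<Longrightarrow> f \<circ> p \<in> loops Y (f b)"
  unfolding mem_loops by (rule path_homotopic_compose)

lemma induced_map_hom:
  assumes "continuous_map X Y f"
  shows "induced_map Y (f b) f \<in> hom (fundamental_group X b) (fundamental_group Y (f b))"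
proof (rule homI)
  fix A B assume "A \<in> carrier (fundamental_group X b)" "B \<in> carrier (fundamental_group X b)"
  then obtain p q where pq: "p \<in> loops X b" "q \<in> loops X b"
    and AB: "A = loop_class X b p" "B = loop_class X b q"
    by (auto simp: fundamental_group_carrier)
  show "induced_map Y (f b) f A \<in> carrier (fundamental_group Y (f b))"
    using assms pq AB by (auto simp: fundamental_group_carrier induced_map_loop_class intro: comp_loops)
  show "induced_map Y (f b) f (A \<otimes>\<^bsub>fundamental_group X b\<^esub> B) =
      induced_map Y (f b) f A \<otimes>\<^bsub>fundamental_group Y (f b)\<^esub> induced_map Y (f b) f B"
    using pq assms
    by (simp add: AB fundamental_group_mult induced_map_loop_class comp_loops loop_join_loops comp_loop_join)
qed

text \<open>A path \<open>p\<close> in a space contracted by \<open>k\<close> gives the square \<open>k (u, p s)\<close>. Pushing the bottom edge of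
  the square across it onto the other three edges is a homotopy relative to the endpoints, and on those
  three edges the square depends only on the endpoints of \<open>p\<close>. The straight-line homotopy \<open>push\<close> in the
  parameter square does the pushing.\<close>

lemma contractible_path_homotopic:
  assumes X: "contractible_space X"
    and p: "pathin X p" "p 0 = a" "p 1 = b" and q: "pathin X q" "q 0 = a" "q 1 = b"
  shows "path_homotopic X a b p q"
proof -
  let ?I = "{0..1} :: real set"
  obtain c where "homotopic_with (\<lambda>_. True) X X id (\<lambda>_. c)"
    using X unfolding contractible_space_def by blast
  then obtain k where k: "continuous_map (prod_topology (top_of_set ?I) X) X k"
    and k0: "\<And>x. k (0, x) = x" and k1: "\<And>x. k (1, x) = c"
    unfolding homotopic_with_def by auto
  \<comment> \<open>\<open>(height s, top s)\<close> runs up the left edge for \<open>s \<le> 1/3\<close>, along the upper edge for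
    \<open>1/3 \<le> s \<le> 2/3\<close>, and then down the right edge; \<open>r\<close> is the image of this route.\<close>
  define top where "top s = min 1 (max 0 (3 * s - 1))" for s :: real
  define height where "height s = min 1 (min (3 * s) (3 - 3 * s))" for s :: real
  define push where "push = (\<lambda>(t, s). (t * height s, (1 - t) * s + t * top s))"
  have rng: "height s \<in> ?I" "top s \<in> ?I" if "s \<in> ?I" for s
    using that by (auto simp: top_def height_def)
  have "continuous_on (?I \<times> ?I) push"
    unfolding push_def top_def height_def case_prod_unfold by (intro continuous_intros)
  moreover have "push \<in> ?I \<times> ?I \<rightarrow> ?I \<times> ?I"
  proof clarify
    fix t s :: real assume ts: "t \<in> ?I" "s \<in> ?I"
    have "(1 - t) * s + t * top s \<in> ?I"
      using ts rng[OF ts(2)] convex_bound_le[of s 1 "top s" "1 - t" t] by auto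
    moreover have "t * height s \<in> ?I" using ts rng[OF ts(2)] by (auto intro: mult_le_one)
    ultimately show "push (t, s) \<in> ?I \<times> ?I" by (simp add: push_def)
  qed
  ultimately have push: "continuous_map (top_of_set (?I \<times> ?I)) (top_of_set (?I \<times> ?I)) push"
    by simp
  define r where "r = (\<lambda>s. if s \<le> 1/3 then k (height s, a) else if s \<le> 2/3 then c else k (height s, b))"
  have onto_r: "path_homotopic X a b p r" if p: "pathin X p" "p 0 = a" "p 1 = b" for p
  proof -
    have "continuous_map (prod_topology (top_of_set ?I) (top_of_set ?I))
        (prod_topology (top_of_set ?I) X) (\<lambda>(u, s). (u, p s))"
      using p(1) by (intro continuous_map_prod_top[THEN iffD2]) (auto simp: pathin_def)
    from continuous_map_compose[OF this k]
    have "continuous_map (top_of_set (?I \<times> ?I)) X (\<lambda>(u, s). k (u, p s))"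
      by (simp add: o_def case_prod_unfold)
    from continuous_map_compose[OF push this]
    have "continuous_map (top_of_set (?I \<times> ?I)) X ((\<lambda>(u, s). k (u, p s)) \<circ> push)" .
    then show ?thesis
    proof (rule path_homotopicI)
      show "((\<lambda>(u, s). k (u, p s)) \<circ> push) (0, s) = p s" for s
        by (simp add: push_def k0)
      show "((\<lambda>(u, s). k (u, p s)) \<circ> push) (1, s) = r s" if "s \<in> ?I" for s
        using that p k1 by (auto simp: push_def r_def top_def height_def min_def max_def)
      show "((\<lambda>(u, s). k (u, p s)) \<circ> push) (t, 0) = a"
        "((\<lambda>(u, s). k (u, p s)) \<circ> push) (t, 1) = b" for t
        using p by (simp_all add: push_def k0 top_def height_def)
    qed
  qed
  show ?thesis
    using onto_r[OF p] onto_r[OF q] by (metis path_homotopic_sym path_homotopic_trans)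
qed

section \<open>Lifting along the quotient by a covering space action\<close>

text \<open>\<open>B\<close> is the orbit space of an action of the discrete group \<open>H\<close> on \<open>E\<close>, and every point of \<open>E\<close> has a
  neighbourhood that is disjoint from its proper translates. These are the properties of a regular
  covering from which the lifting of paths and of homotopies follows.\<close>

locale covering_action = group H for H (structure) +
  fixes E :: "'e topology" and B :: "'f topology" and \<pi> :: "'e \<Rightarrow> 'f" and act :: "'a \<Rightarrow> 'e \<Rightarrow> 'e"
  assumes quotient: "quotient_map E B \<pi>"
    and act_one: "e \<in> topspace E \<Longrightarrow> act \<one> e = e"
    and act_mult: "g \<in> carrier H \<Longrightarrow> h \<in> carrier H \<Longrightarrow> e \<in> topspace E \<Longrightarrow> act (g \<otimes> h) e = act g (act h e)"
    and continuous_act: "g \<in> carrier H \<Longrightarrow> continuous_map E E (act g)"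
    and fibres: "e \<in> topspace E \<Longrightarrow> e' \<in> topspace E \<Longrightarrow> \<pi> e = \<pi> e' \<longleftrightarrow> (\<exists>g \<in> carrier H. e' = act g e)"
    and wandering: "e \<in> topspace E \<Longrightarrow>
      \<exists>U. openin E U \<and> e \<in> U \<and> (\<forall>g \<in> carrier H. \<forall>u \<in> U. act g u \<in> U \<longrightarrow> g = \<one>)"
begin

lemma continuous_pi: "continuous_map E B \<pi>"
  by (rule quotient_imp_continuous_map[OF quotient])

lemma act_closed: "g \<in> carrier H \<Longrightarrow> e \<in> topspace E \<Longrightarrow> act g e \<in> topspace E"
  using continuous_map_funspace[OF continuous_act] by blast

lemma pi_act: "g \<in> carrier H \<Longrightarrow> e \<in> topspace E \<Longrightarrow> \<pi> (act g e) = \<pi> e"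
  using fibres[of e "act g e"] act_closed by metis

lemma act_free:
  assumes "g \<in> carrier H" "e \<in> topspace E" "act g e = e"
  shows "g = \<one>"
  using wandering[OF assms(2)] assms by metis

lemma open_map_pi: "open_map E B \<pi>"
  unfolding open_map_def
proof (intro allI impI)
  fix U assume U: "openin E U"
  have sub: "U \<subseteq> topspace E" using U by (rule openin_subset)
  have "{e \<in> topspace E. \<pi> e \<in> \<pi> ` U} = (\<Union>g \<in> carrier H. {e \<in> topspace E. act g e \<in> U})"
  proof (intro subset_antisym subsetI)
    fix e assume e: "e \<in> {e \<in> topspace E. \<pi> e \<in> \<pi> ` U}"
    then obtain u where u: "u \<in> U" "\<pi> e = \<pi> u" by auto
    then obtain g where "g \<in> carrier H" "u = act g e" using fibres[of e u] e sub by auto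
    then show "e \<in> (\<Union>g \<in> carrier H. {e \<in> topspace E. act g e \<in> U})" using e u by auto
  next
    fix e assume "e \<in> (\<Union>g \<in> carrier H. {e \<in> topspace E. act g e \<in> U})"
    then obtain g where g: "g \<in> carrier H" "e \<in> topspace E" "act g e \<in> U" by auto
    then show "e \<in> {e \<in> topspace E. \<pi> e \<in> \<pi> ` U}"
      using pi_act[OF g(1,2)] by (metis (mono_tags) imageI mem_Collect_eq)
  qed
  moreover have "openin E \<dots>"
    using openin_continuous_map_preimage[OF continuous_act U] by (intro openin_Union) blast
  moreover have "\<pi> ` U \<subseteq> topspace B"
    using continuous_map_image_subset_topspace[OF continuous_pi] sub by blast
  ultimately show "openin B (\<pi> ` U)"
    using quotient unfolding quotient_map_def by metis
qed

text \<open>A neighbourhood \<open>U\<close> that meets none of its proper translates is mapped injectively, and by an open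
  map, hence homeomorphically onto an open set.\<close>

lemma local_section:
  assumes "b \<in> topspace B"
  obtains V \<sigma> where "openin B V" "b \<in> V" "continuous_map (subtopology B V) E \<sigma>"
    "\<And>v. v \<in> V \<Longrightarrow> \<pi> (\<sigma> v) = v"
proof -
  obtain e where e: "e \<in> topspace E" "\<pi> e = b"
    using quotient assms unfolding quotient_map_def by (metis imageE)
  obtain U where U: "openin E U" "e \<in> U"
    and wander: "\<And>g u. g \<in> carrier H \<Longrightarrow> u \<in> U \<Longrightarrow> act g u \<in> U \<Longrightarrow> g = \<one>"
    using wandering[OF e(1)] by blast
  have sub: "U \<subseteq> topspace E" using U by (simp add: openin_subset)
  have inj: "u = u'" if "u \<in> U" "u' \<in> U" "\<pi> u = \<pi> u'" for u u'
    using fibres[of u u'] wander that sub act_one by (metis subsetD)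
  define \<sigma> where "\<sigma> = inv_into U \<pi>"
  have \<sigma>: "\<sigma> v \<in> U" "\<pi> (\<sigma> v) = v" if "v \<in> \<pi> ` U" for v
    unfolding \<sigma>_def using that by (simp_all add: inv_into_into f_inv_into_f)
  have V: "openin B (\<pi> ` U)" using open_map_pi U(1) by (simp add: open_map_def)
  have "continuous_map (subtopology B (\<pi> ` U)) E \<sigma>"
    unfolding continuous_map_def
  proof (intro conjI allI impI)
    have top: "topspace (subtopology B (\<pi> ` U)) = \<pi> ` U"
      using openin_subset[OF V] by auto
    show "\<sigma> \<in> topspace (subtopology B (\<pi> ` U)) \<rightarrow> topspace E"
      unfolding top using \<sigma> sub by auto
    fix W assume "openin E W"
    then have "openin B (\<pi> ` (U \<inter> W))"
      using U(1) open_map_pi by (simp add: open_map_def openin_Int)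
    moreover have "{v \<in> \<pi> ` U. \<sigma> v \<in> W} = \<pi> ` (U \<inter> W)"
    proof (intro subset_antisym subsetI)
      fix v assume v: "v \<in> {v \<in> \<pi> ` U. \<sigma> v \<in> W}"
      then show "v \<in> \<pi> ` (U \<inter> W)" using \<sigma>[of v] by (metis (no_types, lifting) IntI imageI mem_Collect_eq)
    next
      fix v assume "v \<in> \<pi> ` (U \<inter> W)"
      then obtain u where u: "u \<in> U" "u \<in> W" "v = \<pi> u" by auto
      then have "\<sigma> v = u" using \<sigma>[of v] inj[of "\<sigma> v" u] by blast
      then show "v \<in> {v \<in> \<pi> ` U. \<sigma> v \<in> W}" using u by auto
    qed
    ultimately show "openin (subtopology B (\<pi> ` U)) {v \<in> topspace (subtopology B (\<pi> ` U)). \<sigma> v \<in> W}"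
      unfolding top openin_open_subtopology[OF V] by auto
  qed
  with V U(2) e(2) \<sigma>(2) show thesis by (intro that[of "\<pi> ` U" \<sigma>]) auto
qed

definition lift :: "('z::topological_space) set \<Rightarrow> ('z \<Rightarrow> 'f) \<Rightarrow> ('z \<Rightarrow> 'e) \<Rightarrow> bool" where
  "lift S K F \<longleftrightarrow> continuous_map (top_of_set S) E F \<and> (\<forall>z\<in>S. \<pi> (F z) = K z)"

lemma lift_in_topspace: "lift S K F \<Longrightarrow> z \<in> S \<Longrightarrow> F z \<in> topspace E"
  unfolding lift_def using continuous_map_funspace by fastforce

lemma lift_act: "lift S K F \<Longrightarrow> g \<in> carrier H \<Longrightarrow> lift S K (act g \<circ> F)"
  using lift_in_topspace[of S K F] by (auto simp: lift_def pi_act intro: continuous_map_compose continuous_act)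

lemma lift_subset: "lift S K F \<Longrightarrow> T \<subseteq> S \<Longrightarrow> lift T K F"
  unfolding lift_def by (auto intro: continuous_map_from_subtopology_mono)

text \<open>Two lifts differ near each point by one fixed group element, so the set where they agree is open
  and closed.\<close>

lemma lift_unique:
  assumes S: "connected S" and F: "lift S K F" "lift S K F'" and z: "z \<in> S" "F z = F' z" and w: "w \<in> S"
  shows "F w = F' w"
proof -
  have same: "\<exists>N. openin (top_of_set S) N \<and> w \<in> N \<and> (\<forall>v\<in>N. F v = F' v \<longleftrightarrow> F w = F' w)" if w: "w \<in> S" for w
  proof -
    have top: "F v \<in> topspace E" "F' v \<in> topspace E" if "v \<in> S" for v
      using that F by (auto intro: lift_in_topspace)
    have eq: "\<pi> (F v) = \<pi> (F' v)" if "v \<in> S" for v using that F by (simp add: lift_def)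
    obtain g where g: "g \<in> carrier H" "F' w = act g (F w)"
      using fibres[OF top[OF w]] eq[OF w] by blast
    obtain U where U: "openin E U" "F w \<in> U"
      and wander: "\<And>h u. h \<in> carrier H \<Longrightarrow> u \<in> U \<Longrightarrow> act h u \<in> U \<Longrightarrow> h = \<one>"
      using wandering[OF top(1)[OF w]] by blast
    \<comment> \<open>Translated by \<open>inv g\<close>, the second lift passes through the same point over \<open>w\<close> as the first one.\<close>
    let ?F = "act (inv g) \<circ> F'"
    have F'w: "?F w = F w"
      using g top[OF w] by (simp flip: act_mult add: act_one)
    define N where "N = {v \<in> S. F v \<in> U} \<inter> {v \<in> S. ?F v \<in> U}"
    have "lift S K ?F" using lift_act[OF F(2)] g(1) by simp
    then have "openin (top_of_set S) N"
      using openin_continuous_map_preimage[of "top_of_set S" E F U]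
        openin_continuous_map_preimage[of "top_of_set S" E ?F U] F(1) U(1)
      unfolding N_def lift_def by (intro openin_Int) simp_all
    moreover have "w \<in> N" using U(2) w F'w by (simp add: N_def)
    moreover have "F v = F' v \<longleftrightarrow> F w = F' w" if v: "v \<in> N" for v
    proof -
      have vS: "v \<in> S" "F v \<in> U" "?F v \<in> U" using v by (auto simp: N_def)
      obtain k where k: "k \<in> carrier H" "F' v = act k (F v)"
        using fibres[OF top[OF vS(1)]] eq[OF vS(1)] by blast
      have "act (inv g \<otimes> k) (F v) \<in> U"
        using vS(3) k g top[OF vS(1)] by (simp add: act_mult)
      then have "inv g \<otimes> k = \<one>" using wander vS(2) g(1) k(1) by simp
      then have "k = g" using g(1) k(1) by (metis inv_closed inv_equality inv_inv)
      have "F v = F' v \<longleftrightarrow> g = \<one>" if "v \<in> S" "F' v = act g (F v)" for v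
        using act_free[OF g(1) top(1)[OF that(1)]] act_one[OF top(1)[OF that(1)]] that(2) by metis
      with w g(2) vS(1) k(2) \<open>k = g\<close> show ?thesis by blast
    qed
    ultimately show ?thesis by blast
  qed
  have ope: "openin (top_of_set S) {w \<in> S. (F w = F' w) = P}" for P
  proof (subst openin_subopen, intro ballI)
    fix w assume w: "w \<in> {w \<in> S. (F w = F' w) = P}"
    then have "w \<in> S" by simp
    from same[OF this] obtain N where N: "openin (top_of_set S) N" "w \<in> N"
      and eq: "\<And>v. v \<in> N \<Longrightarrow> F v = F' v \<longleftrightarrow> F w = F' w" by blast
    have "N \<subseteq> {w \<in> S. (F w = F' w) = P}"
      using openin_imp_subset[OF N(1)] w eq by auto
    with N show "\<exists>T. openin (top_of_set S) T \<and> w \<in> T \<and> T \<subseteq> {w \<in> S. (F w = F' w) = P}"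
      by (intro exI[of _ N]) simp
  qed
  define A where "A = {w \<in> S. F w = F' w}"
  have "openin (top_of_set S) A" using ope[of True] by (simp add: A_def)
  moreover have "S - A = {w \<in> S. (F w = F' w) = False}" by (auto simp: A_def)
  then have "openin (top_of_set S) (S - A)" using ope[of False] by simp
  then have "closedin (top_of_set S) A"
    by (simp add: closedin_def A_def subset_iff)
  ultimately have "A = {} \<or> A = S" using S connected_clopen by blast
  then show ?thesis using z w by (auto simp: A_def)
qed

text \<open>Over a common point the two lifts differ by one group element. After translating the second lift by
  it, they agree on the connected intersection.\<close>

lemma lift_glue:
  assumes S: "closed S" and T: "closed T" and conn: "connected (S \<inter> T)" and ne: "S \<inter> T \<noteq> {}"
    and F: "lift S K F" and F': "lift T K F'"
  shows "\<exists>F. lift (S \<union> T) K F"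
proof -
  obtain z where z: "z \<in> S" "z \<in> T" using ne by blast
  have "\<pi> (F' z) = \<pi> (F z)" using F F' z by (simp add: lift_def)
  then obtain g where g: "g \<in> carrier H" "F z = act g (F' z)"
    using fibres[OF lift_in_topspace[OF F' z(2)] lift_in_topspace[OF F z(1)]] by blast
  define F2 where "F2 = act g \<circ> F'"
  have F2: "lift T K F2" unfolding F2_def by (rule lift_act[OF F' g(1)])
  have agree: "F w = F2 w" if "w \<in> S \<inter> T" for w
    using lift_unique[OF conn lift_subset[OF F] lift_subset[OF F2], of z w] that z g(2)
    by (simp add: F2_def)
  define L where "L = (\<lambda>w. if w \<in> S then F w else F2 w)"
  have "continuous_map (top_of_set (S \<union> T)) E L"
    unfolding continuous_map_closedin
  proof (intro conjI allI impI)
    show "L \<in> topspace (top_of_set (S \<union> T)) \<rightarrow> topspace E"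
      using lift_in_topspace[OF F] lift_in_topspace[OF F2] by (auto simp: L_def)
    fix C assume C: "closedin E C"
    have "closedin (top_of_set S) {w \<in> S. F w \<in> C}" "closedin (top_of_set T) {w \<in> T. F2 w \<in> C}"
      using closedin_continuous_map_preimage[of "top_of_set S" E F C]
        closedin_continuous_map_preimage[of "top_of_set T" E F2 C] C F F2
      by (simp_all add: lift_def)
    then have "closed {w \<in> S. F w \<in> C}" "closed {w \<in> T. F2 w \<in> C}"
      using S T closedin_closed_trans by blast+
    then have "closed ({w \<in> S. F w \<in> C} \<union> {w \<in> T. F2 w \<in> C})" by (rule closed_Un)
    moreover have "{w \<in> topspace (top_of_set (S \<union> T)). L w \<in> C} = {w \<in> S. F w \<in> C} \<union> {w \<in> T. F2 w \<in> C}"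
      using agree by (auto simp: L_def)
    ultimately show "closedin (top_of_set (S \<union> T)) {w \<in> topspace (top_of_set (S \<union> T)). L w \<in> C}"
      by (metis (no_types, lifting) closed_subset mem_Collect_eq subsetI topspace_euclidean_subtopology)
  qed
  moreover have "\<pi> (L w) = K w" if "w \<in> S \<union> T" for w
    using that F F2 by (auto simp: L_def lift_def)
  ultimately show ?thesis unfolding lift_def by blast
qed

lemma lift_local:
  assumes K: "continuous_map euclidean B K"
  obtains N where "open N" "z \<in> N" "\<And>S. S \<subseteq> N \<Longrightarrow> \<exists>F. lift S K F"
proof -
  have "K z \<in> topspace B" using continuous_map_funspace[OF K] by auto
  then obtain V \<sigma> where V: "openin B V" "K z \<in> V" and \<sigma>: "continuous_map (subtopology B V) E \<sigma>"
    "\<And>v. v \<in> V \<Longrightarrow> \<pi> (\<sigma> v) = v"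
    using local_section by metis
  have "open {w. K w \<in> V}" using openin_continuous_map_preimage[OF K V(1)] by simp
  moreover have "lift S K (\<sigma> \<circ> K)" if "S \<subseteq> {w. K w \<in> V}" for S
  proof -
    have "continuous_map (top_of_set S) (subtopology B V) K"
      using K that by (intro continuous_map_into_subtopology continuous_map_from_subtopology) auto
    then show ?thesis
      using continuous_map_compose[OF _ \<sigma>(1)] \<sigma>(2) that by (auto simp: lift_def)
  qed
  ultimately show thesis using V(2) by (intro that) auto
qed

text \<open>Subdividing first in one direction and then in the other, the rectangle is cut into pieces on which
  local sections give lifts. Two neighbouring pieces meet in a segment, which is connected, so that their
  lifts can be matched.\<close>

lemma lift_rectangle:
  fixes K :: "real \<times> real \<Rightarrow> 'f"
  assumes K: "continuous_map euclidean B K" and "a \<le> b" "c \<le> d"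
  shows "\<exists>F. lift ({a..b} \<times> {c..d}) K F"
  using \<open>c \<le> d\<close>
proof (induction rule: Bolzano)
  case (trans c d e)
  then obtain F F' where "lift ({a..b} \<times> {c..d}) K F" "lift ({a..b} \<times> {d..e}) K F'" by blast
  moreover have "({a..b} \<times> {c..d}) \<inter> ({a..b} \<times> {d..e}) = {a..b} \<times> {d}"
    "({a..b} \<times> {c..d}) \<union> ({a..b} \<times> {d..e}) = {a..b} \<times> {c..e}"
    using trans(3,4) by auto
  moreover have "connected ({a..b} \<times> {d})" by (intro connected_Times) auto
  ultimately show ?case
    using lift_glue[of "{a..b} \<times> {c..d}" "{a..b} \<times> {d..e}" K F F'] \<open>a \<le> b\<close>
    by (simp add: closed_Times)
next
  case (local y)
  have "\<exists>\<delta>>0. \<forall>c d. c \<le> y \<and> y \<le> d \<and> d - c < \<delta> \<longrightarrow> (\<exists>F. lift ({a..b} \<times> {c..d}) K F)"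
    using \<open>a \<le> b\<close>
  proof (induction rule: Bolzano)
    case (trans a b e)
    obtain \<delta>1 where \<delta>1: "\<delta>1 > 0" "\<And>c d. c \<le> y \<Longrightarrow> y \<le> d \<Longrightarrow> d - c < \<delta>1 \<Longrightarrow> \<exists>F. lift ({a..b} \<times> {c..d}) K F"
      using trans(1) by blast
    obtain \<delta>2 where \<delta>2: "\<delta>2 > 0" "\<And>c d. c \<le> y \<Longrightarrow> y \<le> d \<Longrightarrow> d - c < \<delta>2 \<Longrightarrow> \<exists>F. lift ({b..e} \<times> {c..d}) K F"
      using trans(2) by blast
    have "\<exists>F. lift ({a..e} \<times> {c..d}) K F" if cd: "c \<le> y" "y \<le> d" "d - c < min \<delta>1 \<delta>2" for c d
    proof -
      obtain F F' where "lift ({a..b} \<times> {c..d}) K F" "lift ({b..e} \<times> {c..d}) K F'"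
        using \<delta>1(2)[of c d] \<delta>2(2)[of c d] cd by auto
      moreover have "({a..b} \<times> {c..d}) \<inter> ({b..e} \<times> {c..d}) = {b} \<times> {c..d}"
        "({a..b} \<times> {c..d}) \<union> ({b..e} \<times> {c..d}) = {a..e} \<times> {c..d}"
        using trans(3,4) by auto
      moreover have "connected ({b} \<times> {c..d})" by (intro connected_Times) auto
      ultimately show ?thesis
        using lift_glue[of "{a..b} \<times> {c..d}" "{b..e} \<times> {c..d}" K F F'] cd
        by (simp add: closed_Times)
    qed
    with \<delta>1(1) \<delta>2(1) show ?case by (intro exI[of _ "min \<delta>1 \<delta>2"]) simp
  next
    case (local x)
    obtain N where N: "open N" "(x, y) \<in> N" "\<And>S. S \<subseteq> N \<Longrightarrow> \<exists>F. lift S K F"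
      using lift_local[OF K, of "(x, y)"] by blast
    obtain P Q where PQ: "open P" "open Q" "x \<in> P" "y \<in> Q" "P \<times> Q \<subseteq> N"
      using open_prod_elim[OF N(1,2)] by (metis mem_Sigma_iff)
    obtain \<delta> where \<delta>: "\<delta> > 0" "ball x \<delta> \<subseteq> P" using PQ(1,3) openE by blast
    obtain \<epsilon> where \<epsilon>: "\<epsilon> > 0" "ball y \<epsilon> \<subseteq> Q" using PQ(2,4) openE by blast
    have "\<exists>F. lift ({a..b} \<times> {c..d}) K F"
      if "a \<le> x" "x \<le> b" "b - a < \<delta>" "c \<le> y" "y \<le> d" "d - c < \<epsilon>" for a b c d
    proof -
      have "{a..b} \<subseteq> ball x \<delta>" "{c..d} \<subseteq> ball y \<epsilon>"
        using that by (auto simp: dist_real_def)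
      then have "{a..b} \<times> {c..d} \<subseteq> N" using \<delta>(2) \<epsilon>(2) PQ(5) by blast
      then show ?thesis by (rule N(3))
    qed
    with \<delta>(1) \<epsilon>(1) show ?case by blast
  qed
  then show ?case by blast
qed

lemma lift_through:
  assumes F: "lift S K F" and z: "z \<in> S" and e: "e \<in> topspace E" "\<pi> e = K z"
  obtains F' where "lift S K F'" "F' z = e"
proof -
  have "\<pi> (F z) = \<pi> e" using F z e by (simp add: lift_def)
  then obtain g where "g \<in> carrier H" "e = act g (F z)"
    using fibres[OF lift_in_topspace[OF F z] e(1)] by blast
  with lift_act[OF F] that[of "act g \<circ> F"] show thesis by simp
qed

lemma lift_square:
  assumes K: "continuous_map (top_of_set ({0..1} \<times> {0..1})) B K"
    and e: "e \<in> topspace E" "\<pi> e = K (0, 0)"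
  obtains F where "lift ({0..1::real} \<times> {0..1::real}) K F" "F (0, 0) = e"
proof -
  let ?I = "{0..1} \<times> {0..1} :: (real \<times> real) set"
  \<comment> \<open>Retracting the plane onto the square extends \<open>K\<close> to a map that is continuous everywhere, as the
    subdivision argument for rectangles requires.\<close>
  define clamp where "clamp s = max 0 (min 1 s)" for s :: real
  define r where "r = (\<lambda>(t, s). (clamp t, clamp s))"
  have "continuous_on UNIV r"
    unfolding r_def clamp_def case_prod_unfold by (intro continuous_intros)
  moreover have "r z \<in> ?I" for z by (auto simp: r_def clamp_def split: prod.split)
  ultimately have "continuous_map euclidean (top_of_set ?I) r"
    by (intro continuous_map_into_subtopology) auto
  from continuous_map_compose[OF this K] have "continuous_map euclidean B (K \<circ> r)" .
  then obtain F where "lift ?I (K \<circ> r) F"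
    using lift_rectangle[of "K \<circ> r" 0 1 0 1] by auto
  moreover have "(K \<circ> r) z = K z" if "z \<in> ?I" for z
    using that by (auto simp: r_def clamp_def)
  ultimately have "lift ?I K F" by (simp add: lift_def)
  from lift_through[OF this, of "(0, 0)" e] e that show thesis by auto
qed

lemma lift_path:
  assumes p: "pathin B p" and e: "e \<in> topspace E" "\<pi> e = p 0"
  obtains p' where "lift {0..1} p p'" "p' 0 = e"
proof -
  have "continuous_map (top_of_set ({0..1} \<times> {0..1})) (top_of_set {0..1}) (snd :: real \<times> real \<Rightarrow> real)"
    by (auto intro: continuous_intros)
  from continuous_map_compose[OF this p[unfolded pathin_def]]
  obtain F where F: "lift ({0..1} \<times> {0..1}) (p \<circ> snd) F" "F (0::real, 0) = e"
    using lift_square[of "p \<circ> snd" e] e by auto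
  have "continuous_map (top_of_set {0..1}) (top_of_set ({0..1} \<times> {0..1})) (Pair (0::real) :: real \<Rightarrow> _)"
    by (auto intro!: continuous_intros)
  from continuous_map_compose[OF this, of E F] F(1) have "lift {0..1} p (F \<circ> Pair 0)"
    by (simp add: lift_def)
  with F(2) that show thesis by simp
qed

text \<open>The vertical edges of the lifted square are constant, as lifts of constant paths.\<close>

lemma path_homotopic_lift_endpoints:
  assumes pq: "path_homotopic B a b p q" and p': "lift {0..1} p p'" and q': "lift {0..1} q q'"
    and start: "p' 0 = q' 0"
  shows "p' 1 = q' 1"
proof -
  obtain K :: "real \<times> real \<Rightarrow> 'f" where K: "continuous_map (top_of_set ({0..1} \<times> {0..1})) B K"
    and Kp: "\<And>s. s \<in> {0..1} \<Longrightarrow> K (0, s) = p s" and Kq: "\<And>s. s \<in> {0..1} \<Longrightarrow> K (1, s) = q s"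
    and Ka: "\<And>t. t \<in> {0..1} \<Longrightarrow> K (t, 0) = a" and Kb: "\<And>t. t \<in> {0..1} \<Longrightarrow> K (t, 1) = b"
    by (rule path_homotopicE[OF pq]) blast
  have "p' 0 \<in> topspace E" "\<pi> (p' 0) = K (0, 0)"
    using lift_in_topspace[OF p', of 0] p' Kp[of 0] by (auto simp: lift_def)
  then obtain F where F: "lift ({0..1} \<times> {0..1}) K F" "F (0, 0) = p' 0"
    using lift_square[OF K] by blast
  \<comment> \<open>Each edge of the lifted square is the lift of the corresponding edge of the homotopy.\<close>
  have edge: "lift {0..1} (K \<circ> i) (F \<circ> i)" if "continuous_on {0..1} i" "i \<in> {0..1} \<rightarrow> {0..1} \<times> {0..1}"
    for i :: "real \<Rightarrow> real \<times> real"
  proof -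
    have "continuous_map (top_of_set {0..1}) E (F \<circ> i)"
      using F(1) that unfolding lift_def
      by (intro continuous_map_compose[of _ "top_of_set ({0..1} \<times> {0..1})"]) auto
    moreover have "\<pi> (F (i s)) = K (i s)" if "s \<in> {0..1}" for s
    proof -
      have "i s \<in> {0..1} \<times> {0..1}" using \<open>i \<in> {0..1} \<rightarrow> {0..1} \<times> {0..1}\<close> that by (rule funcset_mem)
      then show ?thesis using F(1) unfolding lift_def by (elim conjE) (rule bspec)
    qed
    ultimately show ?thesis by (simp add: lift_def)
  qed
  have cI: "continuous_on {0..1} (Pair t)" "continuous_on {0..1} (\<lambda>t. (t, s))" for t s :: real
    by (auto intro!: continuous_intros)
  have const: "lift {0..1} f (\<lambda>_. x)" if "x \<in> topspace E" "\<And>s. s \<in> {0..1} \<Longrightarrow> f s = \<pi> x"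
    for f :: "real \<Rightarrow> 'f" and x
    using that by (simp add: lift_def)
  have I: "connected {0..1::real}" "(0::real) \<in> {0..1}" "(1::real) \<in> {0..1}" by auto
  have l0: "lift {0..1} p (F \<circ> Pair 0)"
    using edge[OF cI(1)[of 0]] Kp by (auto simp: lift_def)
  have l1: "lift {0..1} q (F \<circ> Pair 1)"
    using edge[OF cI(1)[of 1]] Kq by (auto simp: lift_def)
  have v0: "lift {0..1} (\<lambda>_. a) (F \<circ> (\<lambda>t. (t, 0)))"
    using edge[OF cI(2)[of 0]] Ka by (auto simp: lift_def)
  have v1: "lift {0..1} (\<lambda>_. b) (F \<circ> (\<lambda>t. (t, 1)))"
    using edge[OF cI(2)[of 1]] Kb by (auto simp: lift_def)
  have corner: "\<pi> (F (0, 0)) = a" "\<pi> (F (0, 1)) = b"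
    using F(1) Ka[of 0] Kb[of 0] unfolding lift_def by simp_all
  have c0: "lift {0..1::real} (\<lambda>_. a) (\<lambda>_. F (0, 0))"
    using lift_in_topspace[OF v0 I(2)] corner(1) by (intro const) simp_all
  have c1: "lift {0..1::real} (\<lambda>_. b) (\<lambda>_. F (0, 1))"
    using lift_in_topspace[OF v1 I(2)] corner(2) by (intro const) simp_all
  have "F (0, 0) = F (1, 0)"
    using lift_unique[OF I(1) v0 c0 I(2) _ I(3)] by simp
  moreover have "F (0, 1) = F (1, 1)"
    using lift_unique[OF I(1) v1 c1 I(2) _ I(3)] by simp
  moreover have "F (0, 1) = p' 1"
    using lift_unique[OF I(1) l0 p' I(2) _ I(3)] F(2) by simp
  moreover have "F (1, 1) = q' 1"
    using lift_unique[OF I(1) l1 q' I(2) _ I(3)] F(2) start \<open>F (0, 0) = F (1, 0)\<close> by simp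
  ultimately show ?thesis by simp
qed

end

section \<open>The simplicial set of all tuples\<close>

definition tuples :: "'a set \<Rightarrow> 'a list sset" where
  "tuples S =
    \<lparr>simplices = (\<lambda>n. {xs. length xs = Suc n \<and> set xs \<subseteq> S}),
     face = (\<lambda>n i xs. take i xs @ drop (Suc i) xs),
     degen = (\<lambda>n i xs. take (Suc i) xs @ drop i xs)\<rparr>"

lemma simplices_tuples:
  "simplices (tuples S) n = {xs. length xs = Suc n \<and> (\<forall>k\<le>n. xs ! k \<in> S)}"
  by (simp add: tuples_def subset_code(1) all_set_conv_all_nth less_Suc_eq_le cong: conj_cong)

lemma length_face_tuples:
  "length xs = Suc (Suc n) \<Longrightarrow> i \<le> Suc n \<Longrightarrow> length (face (tuples S) (Suc n) i xs) = Suc n"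
  by (auto simp: tuples_def)

lemma length_degen_tuples:
  "length xs = Suc n \<Longrightarrow> i \<le> n \<Longrightarrow> length (degen (tuples S) n i xs) = Suc (Suc n)"
  by (auto simp: tuples_def)

lemma face_tuples_nth:
  "length xs = Suc (Suc n) \<Longrightarrow> i \<le> Suc n \<Longrightarrow> j \<le> n \<Longrightarrow>
    face (tuples S) (Suc n) i xs ! j = (if j < i then xs ! j else xs ! Suc j)"
  unfolding tuples_def by (simp add: nth_delete)

lemma degen_tuples_nth:
  "length xs = Suc n \<Longrightarrow> i \<le> n \<Longrightarrow> j \<le> Suc n \<Longrightarrow>
    degen (tuples S) n i xs ! j = (if j \<le> i then xs ! j else xs ! (j - 1))"
  unfolding tuples_def by (simp add: nth_repeat)

lemmas tuples_simps = simplices_tuples length_face_tuples length_degen_tuples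
  face_tuples_nth degen_tuples_nth less_Suc_eq_le

lemma simplicial_set_tuples: "simplicial_set (tuples S)"
  unfolding simplicial_set_def
  apply (intro conjI)
  subgoal by (auto simp: tuples_simps)
  subgoal by (auto simp: tuples_simps)
  subgoal by (intro allI ballI impI nth_equalityI; auto simp: tuples_simps)
  subgoal by (intro allI ballI impI nth_equalityI; auto simp: tuples_simps)
  subgoal by (intro allI ballI impI nth_equalityI; auto simp: tuples_simps)
  subgoal by (intro allI ballI impI conjI nth_equalityI; auto simp: tuples_simps)
  subgoal by (intro allI ballI impI nth_equalityI; auto simp: tuples_simps)
  done

text \<open>Left translations of a group by its elements are the case of interest.\<close>

lemma simplicial_map_tuples:
  assumes "f \<in> S \<rightarrow> T"
  shows "simplicial_map (tuples S) (tuples T) (\<lambda>n. map f)"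
  using assms by (auto simp: simplicial_map_def tuples_def take_map drop_map Pi_iff subset_iff)

subsection \<open>Contractibility\<close>

text \<open>The point at parameter \<open>s\<close> on the segment from \<open>t\<close>, in the face opposite to the last vertex, to the
  last vertex of the \<open>(n + 1)\<close>-simplex.\<close>

definition cone_pt :: "nat \<Rightarrow> real \<Rightarrow> (nat \<Rightarrow> real) \<Rightarrow> nat \<Rightarrow> real" where
  "cone_pt n s t = (\<lambda>j. (1 - s) * t j + s * (if j = Suc n then 1 else 0))"

lemma cone_pt_in_standard_simplex:
  assumes "t \<in> standard_simplex n" "0 \<le> s" "s \<le> 1"
  shows "cone_pt n s t \<in> standard_simplex (Suc n)"
  unfolding cone_pt_def
  using assms standard_simplex_mono[of n "Suc n"] by (intro convex_standard_simplex) auto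

lemma continuous_map_cone_pt:
  "continuous_map (prod_topology (top_of_set {0..1}) (simplex_top n)) (simplex_top (Suc n))
    (\<lambda>(s, t). cone_pt n s t)"
proof (rule continuous_map_into_subtopology)
  have fst: "continuous_map (prod_topology (top_of_set {0..1}) (simplex_top n)) euclideanreal fst"
    using continuous_map_fst[of "top_of_set {0..1}" "simplex_top n"]
    by (rule continuous_map_into_fulltopology)
  have "continuous_map (prod_topology (top_of_set {0..1}) (simplex_top n)) (powertop_real UNIV) snd"
    by (rule continuous_map_into_fulltopology[OF continuous_map_snd])
  from continuous_map_compose[OF this continuous_map_product_projection]
  have snd: "continuous_map (prod_topology (top_of_set {0..1}) (simplex_top n)) euclideanreal (\<lambda>z. snd z j)" for j
    by (simp add: o_def)
  show "continuous_map (prod_topology (top_of_set {0..1}) (simplex_top n)) (powertop_real UNIV)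
      (\<lambda>(s, t). cone_pt n s t)"
    unfolding continuous_map_componentwise_UNIV
    by (auto simp: cone_pt_def case_prod_unfold intro!: fst snd continuous_intros)
  show "(\<lambda>(s, t). cone_pt n s t) \<in> topspace (prod_topology (top_of_set {0..1}) (simplex_top n))
      \<rightarrow> standard_simplex (Suc n)"
    by (auto simp: cone_pt_in_standard_simplex)
qed

lemma append_in_tuples:
  "x \<in> simplices (tuples S) n \<Longrightarrow> b \<in> S \<Longrightarrow> x @ [b] \<in> simplices (tuples S) (Suc n)"
  by (auto simp: tuples_def)

lemma glue_invariant_cone:
  assumes b: "b \<in> S" and s: "0 \<le> s" "s \<le> 1"
  shows "glue_invariant (tuples S) (\<lambda>n x t. realization_pt (tuples S) (Suc n) (x @ [b]) (cone_pt n s t))"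
  unfolding glue_invariant_def
proof (intro conjI allI impI)
  note inv = glue_invariant_realization_pt[OF simplicial_set_tuples, of S, unfolded glue_invariant_def]
  fix n i x and t :: "nat \<Rightarrow> real"
  {
    assume x: "x \<in> simplices (tuples S) (Suc n)" and i: "i \<le> Suc n" and t: "t \<in> standard_simplex n"
    have "face (tuples S) (Suc n) i x @ [b] = face (tuples S) (Suc (Suc n)) i (x @ [b])"
      using x i by (auto simp: tuples_def)
    moreover have "simplical_face i (cone_pt n s t) = cone_pt (Suc n) s (simplical_face i t)"
      using i by (auto simp: simplical_face_def cone_pt_def fun_eq_iff)
    ultimately show "realization_pt (tuples S) (Suc n) (face (tuples S) (Suc n) i x @ [b]) (cone_pt n s t) =
        realization_pt (tuples S) (Suc (Suc n)) (x @ [b]) (cone_pt (Suc n) s (simplical_face i t))"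
      using inv append_in_tuples[OF x b] cone_pt_in_standard_simplex[OF t s] i by simp
  }
  {
    assume x: "x \<in> simplices (tuples S) n" and i: "i \<le> n" and t: "t \<in> standard_simplex (Suc n)"
    have "degen (tuples S) n i x @ [b] = degen (tuples S) (Suc n) i (x @ [b])"
      using x i by (auto simp: tuples_def)
    moreover have "simplical_degen i (cone_pt (Suc n) s t) = cone_pt n s (simplical_degen i t)"
      using i by (auto simp: simplical_degen_def cone_pt_def fun_eq_iff algebra_simps)
    ultimately show "realization_pt (tuples S) (Suc (Suc n)) (degen (tuples S) n i x @ [b]) (cone_pt (Suc n) s t) =
        realization_pt (tuples S) (Suc n) (x @ [b]) (cone_pt n s (simplical_degen i t))"
      using inv append_in_tuples[OF x b] cone_pt_in_standard_simplex[OF t s] i by simp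
  }
qed

text \<open>Deleting the first entry does not affect the last vertex, so that all entries but the last one can be
  removed.\<close>

lemma realization_pt_last_vertex:
  "x \<in> simplices (tuples S) n \<Longrightarrow>
    realization_pt (tuples S) n x (\<lambda>j. if j = n then 1 else 0) = realization_vertex (tuples S) [last x]"
proof (induction n arbitrary: x)
  case 0
  then have "x = [last x]" by (auto simp: tuples_def length_Suc_conv)
  then show ?case by (simp add: realization_vertex_def)
next
  case (Suc n)
  let ?e = "\<lambda>n j. if j = n then 1 else 0 :: real"
  have f: "face (tuples S) (Suc n) 0 x = tl x" by (simp add: tuples_def drop_Suc)
  have "simplical_face 0 (?e n) = ?e (Suc n)" by (auto simp: simplical_face_def fun_eq_iff)
  then have "realization_pt (tuples S) (Suc n) x (?e (Suc n)) = realization_pt (tuples S) n (tl x) (?e n)"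
    using glue_invariant_realization_pt[OF simplicial_set_tuples, of S] Suc.prems
    unfolding glue_invariant_def by (metis f basis_in_standard_simplex le0 order_refl)
  also have "\<dots> = realization_vertex (tuples S) [last (tl x)]"
    using Suc.prems simplicial_set_closed(1)[OF simplicial_set_tuples Suc.prems, of 0] f
    by (intro Suc.IH) simp
  also have "last (tl x) = last x"
    using Suc.prems by (cases x) (auto simp: tuples_def)
  finally show ?case .
qed

text \<open>Appending a fixed vertex \<open>b\<close> to every tuple is a cone on the realization; sliding each point along its
  cone line moves it to \<open>b\<close>. The appended vertex comes last so that the face and degeneracy indices of the
  original tuple stay the same.\<close>

lemma contractible_realization_tuples:
  assumes b: "b \<in> S"
  shows "contractible_space (realization (tuples S))"
proof -
  let ?E = "realization (tuples S)"
  define F where "F s = (\<lambda>n x t. realization_pt (tuples S) (Suc n) (x @ [b]) (cone_pt n s t))" for s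
  define K where "K = (\<lambda>(s, p). descend (\<lambda>((n, x), t). F s n x t) p)"
  have K: "K (s, realization_pt (tuples S) n x t) = F s n x t"
    if "x \<in> simplices (tuples S) n" "t \<in> standard_simplex n" "s \<in> {0..1}" for s n x t
    unfolding K_def prod.case using that
    by (intro descend_realization_pt) (auto simp: F_def intro: glue_invariant_cone[OF b])
  have "continuous_map (prod_topology (top_of_set {0..1}) ?E) ?E K"
  proof (rule continuous_map_prod_realization)
    show "locally_compact_space (top_of_set {0..1::real})"
      by (simp add: compact_imp_locally_compact_space compact_space_subtopology)
    show "Hausdorff_space (top_of_set {0..1::real})"
      by (simp add: Hausdorff_space_subtopology)
    fix n x assume x: "x \<in> simplices (tuples S) n"
    have "continuous_map (prod_topology (top_of_set {0..1}) (simplex_top n)) ?E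
        (realization_pt (tuples S) (Suc n) (x @ [b]) \<circ> (\<lambda>(s, t). cone_pt n s t))"
      by (rule continuous_map_compose[OF continuous_map_cone_pt
            continuous_map_realization_pt[OF append_in_tuples[OF x b]]])
    then show "continuous_map (prod_topology (top_of_set {0..1}) (simplex_top n)) ?E
        (\<lambda>(s, t). K (s, realization_pt (tuples S) n x t))"
      by (rule continuous_map_eq) (auto simp: K[OF x] F_def)
  qed
  moreover have "K (0, p) = id p" if p: "p \<in> topspace ?E" for p
    using p
  proof (cases rule: realization_cases)
    fix n x and t :: "nat \<Rightarrow> real"
    assume x: "x \<in> simplices (tuples S) n" and t: "t \<in> standard_simplex n"
      and p: "p = realization_pt (tuples S) n x t"
    have "t j = 0" if "j > n" for j using t that by (simp add: standard_simplex_def)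
    then have "simplical_face (Suc n) t = cone_pt n 0 t"
      by (auto simp: simplical_face_def cone_pt_def fun_eq_iff)
    moreover have "face (tuples S) (Suc n) (Suc n) (x @ [b]) = x"
      using x by (simp add: tuples_def)
    ultimately have "F 0 n x t = realization_pt (tuples S) n x t"
      using glue_invariant_realization_pt[OF simplicial_set_tuples, of S] append_in_tuples[OF x b] t
      unfolding glue_invariant_def F_def by (metis order_refl)
    then show ?thesis using K[OF x t, of 0] p by simp
  qed
  moreover have "K (1, p) = realization_vertex (tuples S) [b]" if p: "p \<in> topspace ?E" for p
    using p
  proof (cases rule: realization_cases)
    fix n x and t :: "nat \<Rightarrow> real"
    assume x: "x \<in> simplices (tuples S) n" and t: "t \<in> standard_simplex n"
      and p: "p = realization_pt (tuples S) n x t"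
    have "cone_pt n 1 t = (\<lambda>j. if j = Suc n then 1 else 0)" by (simp add: cone_pt_def)
    then show ?thesis
      using K[OF x t, of 1] p realization_pt_last_vertex[OF append_in_tuples[OF x b]] by (simp add: F_def)
  qed
  ultimately have "homotopic_with (\<lambda>_. True) ?E ?E id (\<lambda>_. realization_vertex (tuples S) [b])"
    by (subst homotopic_with) (simp, intro exI[of _ K], simp)
  then show ?thesis unfolding contractible_space_def by blast
qed

subsection \<open>Agreement of step functions\<close>

text \<open>The point \<open>t\<close> of the simplex \<open>(x\<^sub>0, \<dots>, x\<^sub>n)\<close> is encoded by the step function on the unit interval that
  takes the value \<open>x\<^sub>i\<close> on an interval of length \<open>t\<^sub>i\<close>; this interval begins at \<open>psum t i\<close>. The gluing relation
  does not change the step function: a face map inserts an interval of length zero, and a degeneracy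
  cuts an interval into two.\<close>

definition psum :: "(nat \<Rightarrow> real) \<Rightarrow> nat \<Rightarrow> real" where
  "psum t j = sum t {..<j}"

lemma psum_simps [simp]: "psum t 0 = 0" "psum t (Suc j) = psum t j + t j"
  by (simp_all add: psum_def)

lemma psum_simplex:
  assumes "t \<in> standard_simplex n"
  shows "psum t (Suc n) = 1" "psum t j \<le> psum t (Suc j)" "0 \<le> psum t j"
    and "j \<le> Suc n \<Longrightarrow> psum t j \<le> 1"
proof -
  have t: "\<And>j. 0 \<le> t j" "sum t {..n} = 1" using assms by (auto simp: standard_simplex_def)
  show 1: "psum t (Suc n) = 1" using t(2) by (simp only: psum_def lessThan_Suc_atMost)
  show "psum t j \<le> psum t (Suc j)" "0 \<le> psum t j" using t(1) by (simp_all add: sum_nonneg psum_def)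
  assume "j \<le> Suc n"
  then have "psum t j \<le> psum t (Suc n)"
    unfolding psum_def using t(1) by (intro sum_mono2) auto
  then show "psum t j \<le> 1" using 1 by simp
qed

lemma psum_face: "psum (simplical_face i t) j = (if j \<le> i then psum t j else psum t (j - 1))"
proof (induction j)
  case (Suc j)
  then show ?case by (cases j) (auto simp: simplical_face_def not_le less_Suc_eq)
qed simp

lemma psum_degen: "psum (simplical_degen i t) j = (if j \<le> i then psum t j else psum t (Suc j))"
  by (induction j) (auto simp: simplical_degen_def not_le less_Suc_eq)

lemma sum_atMost_remove:
  fixes f :: "nat \<Rightarrow> real"
  shows "i \<le> Suc n \<Longrightarrow> (\<Sum>k\<le>Suc n. f k) = f i + (\<Sum>k\<le>n. f (if k < i then k else Suc k))"
proof (induction n)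
  case 0
  then show ?case by (cases i) auto
next
  case (Suc n)
  show ?case
  proof (cases "i = Suc (Suc n)")
    case True
    then have "(\<Sum>k\<le>Suc n. f (if k < i then k else Suc k)) = (\<Sum>k\<le>Suc n. f k)"
      by (intro sum.cong) auto
    then show ?thesis using True by simp
  next
    case False
    then show ?thesis using Suc by simp
  qed
qed

text \<open>For \<open>\<psi> h s\<close> the measure of the part of \<open>[0, s]\<close> on which a given step function takes the value \<open>h\<close>,
  this is the measure of the set on which the given function agrees with the one encoded by \<open>x\<close> and \<open>t\<close>.\<close>

definition agreement :: "('a \<Rightarrow> real \<Rightarrow> real) \<Rightarrow> nat \<Rightarrow> 'a list \<Rightarrow> (nat \<Rightarrow> real) \<Rightarrow> real" where
  "agreement \<psi> n x t = (\<Sum>i\<le>n. \<psi> (x ! i) (psum t (Suc i)) - \<psi> (x ! i) (psum t i))"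

lemma glue_invariant_agreement: "glue_invariant (tuples S) (agreement \<psi>)"
  unfolding glue_invariant_def
proof (intro conjI allI impI)
  fix n i x and t :: "nat \<Rightarrow> real"
  {
    assume x: "x \<in> simplices (tuples S) (Suc n)" and i: "i \<le> Suc n"
    have "agreement \<psi> (Suc n) x (simplical_face i t)
        = 0 + (\<Sum>k\<le>n. \<psi> (x ! (if k < i then k else Suc k)) (psum t (Suc k))
            - \<psi> (x ! (if k < i then k else Suc k)) (psum t k))"
      unfolding agreement_def sum_atMost_remove[OF i]
      by (intro arg_cong2[of _ _ _ _ "(+)"] sum.cong)
        (auto simp: psum_face simp del: psum_simps(2))
    also have "\<dots> = agreement \<psi> n (face (tuples S) (Suc n) i x) t"
      unfolding agreement_def add_0 using x i by (intro sum.cong) (auto simp: tuples_simps)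
    finally show "agreement \<psi> n (face (tuples S) (Suc n) i x) t
        = agreement \<psi> (Suc n) x (simplical_face i t)" by simp
  }
  {
    assume x: "x \<in> simplices (tuples S) n" and i: "i \<le> n"
    \<comment> \<open>The contributions of the degenerate simplex, in which the entry with index \<open>i\<close> is repeated: those
      with indices \<open>i\<close> and \<open>Suc i\<close> telescope to the contribution of one interval.\<close>
    define D where "D k = \<psi> (x ! (if k \<le> i then k else k - 1)) (psum t (Suc k))
        - \<psi> (x ! (if k \<le> i then k else k - 1)) (psum t k)" for k
    have "agreement \<psi> (Suc n) (degen (tuples S) n i x) t = (\<Sum>k\<le>Suc n. D k)"
      unfolding agreement_def D_def using x i by (intro sum.cong) (auto simp: tuples_simps simp del: psum_simps(2))
    also have "\<dots> = D (Suc i) + (\<Sum>k\<le>n. D (if k < Suc i then k else Suc k))"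
      using i by (intro sum_atMost_remove) simp
    also have "\<dots> = (\<Sum>k\<le>n. D (if k < Suc i then k else Suc k) + (if k = i then D (Suc i) else 0))"
      using i by (simp add: sum.distrib)
    also have "\<dots> = agreement \<psi> n x (simplical_degen i t)"
      unfolding agreement_def by (intro sum.cong) (auto simp: D_def psum_degen simp del: psum_simps(2))
    finally show "agreement \<psi> (Suc n) (degen (tuples S) n i x) t = agreement \<psi> n x (simplical_degen i t)" .
  }
qed

lemma continuous_map_agreement:
  assumes "\<And>h. continuous_on UNIV (\<psi> h)"
  shows "continuous_map (simplex_top n) euclideanreal (agreement \<psi> n x)"
proof -
  have "continuous_map (simplex_top n) euclideanreal (\<lambda>t. psum t j)" for j
    unfolding psum_def
    by (intro continuous_map_sum continuous_map_from_subtopology continuous_map_product_projection) auto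
  then have "continuous_map (simplex_top n) euclideanreal (\<psi> h \<circ> (\<lambda>t. psum t j))" for h j
    using assms by (intro continuous_map_compose[of _ euclideanreal]) auto
  then have "continuous_map (simplex_top n) euclideanreal (\<lambda>t. \<psi> h (psum t j))" for h j
    by (simp add: o_def)
  then show ?thesis
    unfolding agreement_def[abs_def] by (intro continuous_map_sum continuous_map_diff) (simp_all del: psum_simps)
qed

text \<open>The length of the part of \<open>[0, s]\<close> inside the \<open>j\<close>-th interval of the subdivision given by \<open>u\<close>.\<close>

definition overlap :: "(nat \<Rightarrow> real) \<Rightarrow> nat \<Rightarrow> real \<Rightarrow> real" where
  "overlap u j s = min s (psum u (Suc j)) - min s (psum u j)"

definition occupation :: "nat \<Rightarrow> 'a list \<Rightarrow> (nat \<Rightarrow> real) \<Rightarrow> 'a \<Rightarrow> real \<Rightarrow> real" where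
  "occupation m y u h s = (\<Sum>j \<in> {j. j \<le> m \<and> y ! j = h}. overlap u j s)"

lemma overlap_mono:
  assumes "u \<in> standard_simplex m" "a \<le> b"
  shows "overlap u j a \<le> overlap u j b"
  using psum_simplex(2)[OF assms(1), of j] assms(2) by (auto simp: overlap_def min_def)

lemma sum_overlap:
  assumes u: "u \<in> standard_simplex m" and s: "0 \<le> s" "s \<le> 1"
  shows "(\<Sum>j\<le>m. overlap u j s) = s"
proof -
  have "(\<Sum>j<Suc m. min s (psum u (Suc j)) - min s (psum u j)) = min s (psum u (Suc m)) - min s (psum u 0)"
    by (rule sum_lessThan_telescope)
  then show ?thesis
    using psum_simplex(1)[OF u] s by (simp only: overlap_def lessThan_Suc_atMost) simp
qed

text \<open>The intervals on which the step function takes the values \<open>h\<close> and \<open>h'\<close> are disjoint, so that together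
  they occupy no more than the whole of \<open>[a, b]\<close>.\<close>

lemma occupation_disjoint:
  assumes u: "u \<in> standard_simplex m" and ab: "0 \<le> a" "a \<le> b" "b \<le> 1" and h: "h \<noteq> h'"
  shows "(occupation m y u h b - occupation m y u h a) + (occupation m y u h' b - occupation m y u h' a)
    \<le> b - a"
proof -
  let ?w = "\<lambda>j. overlap u j b - overlap u j a"
  let ?A = "{j. j \<le> m \<and> y ! j = h}" and ?B = "{j. j \<le> m \<and> y ! j = h'}"
  have "(occupation m y u h b - occupation m y u h a) + (occupation m y u h' b - occupation m y u h' a)
      = sum ?w ?A + sum ?w ?B"
    by (simp add: occupation_def sum_subtractf)
  also have "\<dots> = sum ?w (?A \<union> ?B)"
    using h by (intro sum.union_disjoint[symmetric]) auto
  also have "\<dots> \<le> sum ?w {..m}"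
    using overlap_mono[OF u ab(2)] by (intro sum_mono2) auto
  also have "\<dots> = b - a"
    using ab by (simp add: sum_subtractf sum_overlap[OF u])
  finally show ?thesis .
qed

lemma agreement_self:
  assumes u: "u \<in> standard_simplex m"
  shows "agreement (occupation m y u) m y u \<ge> 1"
proof -
  have "u i \<le> occupation m y u (y ! i) (psum u (Suc i)) - occupation m y u (y ! i) (psum u i)"
    if i: "i \<le> m" for i
  proof -
    let ?w = "\<lambda>j. overlap u j (psum u (Suc i)) - overlap u j (psum u i)"
    have "u i = ?w i" using psum_simplex(2)[OF u, of i] by (simp add: overlap_def min_def)
    also have "\<dots> \<le> sum ?w {j. j \<le> m \<and> y ! j = y ! i}"
      using i overlap_mono[OF u psum_simplex(2)[OF u]] by (intro member_le_sum) auto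
    finally show ?thesis by (simp add: occupation_def sum_subtractf)
  qed
  then have "sum u {..m} \<le> agreement (occupation m y u) m y u"
    unfolding agreement_def by (intro sum_mono) simp
  then show ?thesis using u by (simp add: standard_simplex_def)
qed

text \<open>Two step functions that differ everywhere agree with a third one on disjoint sets.\<close>

lemma agreement_disjoint:
  assumes u: "u \<in> standard_simplex m" and t: "t \<in> standard_simplex n"
    and x: "\<And>i. i \<le> n \<Longrightarrow> x ! i \<noteq> x' ! i"
  shows "agreement (occupation m y u) n x t + agreement (occupation m y u) n x' t \<le> 1"
proof -
  have "agreement (occupation m y u) n x t + agreement (occupation m y u) n x' t
      \<le> (\<Sum>i\<le>n. psum t (Suc i) - psum t i)"
    unfolding agreement_def sum.distrib[symmetric]
    using psum_simplex[OF t] x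
    by (intro sum_mono occupation_disjoint[OF u]) (simp_all del: psum_simps(2))
  also have "\<dots> = 1"
    using t by (simp add: standard_simplex_def)
  finally show ?thesis .
qed

lemma continuous_on_occupation: "continuous_on UNIV (occupation m y u h)"
  unfolding occupation_def[abs_def] overlap_def by (intro continuous_intros)

section \<open>The universal cover of the classifying space\<close>

text \<open>All tuples in the group, that is, the usual total space over the classifying space, contractible and
  with a free action by left translation. When the group is abelian, it is also \<^const>\<open>E_com\<close>.\<close>

definition universal_cover :: "('a, 'b) monoid_scheme \<Rightarrow> 'a list cell_pt set topology" where
  "universal_cover H = realization (tuples (carrier H))"

definition consecutive_quotients :: "('a, 'b) monoid_scheme \<Rightarrow> nat \<Rightarrow> 'a list \<Rightarrow> 'a list" where
  "consecutive_quotients H n xs = map (\<lambda>i. inv\<^bsub>H\<^esub> (xs ! i) \<otimes>\<^bsub>H\<^esub> xs ! Suc i) [0..<n]"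

definition covering_map :: "('a, 'b) monoid_scheme \<Rightarrow> 'a list cell_pt set \<Rightarrow> 'a list cell_pt set" where
  "covering_map H = realization_map (nerve H) (consecutive_quotients H)"

definition translation :: "('a, 'b) monoid_scheme \<Rightarrow> 'a \<Rightarrow> 'a list cell_pt set \<Rightarrow> 'a list cell_pt set" where
  "translation H g = realization_map (tuples (carrier H)) (\<lambda>n. map (\<lambda>x. g \<otimes>\<^bsub>H\<^esub> x))"

fun partial_products :: "('a, 'b) monoid_scheme \<Rightarrow> 'a \<Rightarrow> 'a list \<Rightarrow> 'a list" where
  "partial_products H g [] = [g]"
| "partial_products H g (h # hs) = g # partial_products H (g \<otimes>\<^bsub>H\<^esub> h) hs"

lemma length_consecutive_quotients [simp]: "length (consecutive_quotients H n xs) = n"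
  by (simp add: consecutive_quotients_def)

lemma consecutive_quotients_nth:
  "k < n \<Longrightarrow> consecutive_quotients H n xs ! k = inv\<^bsub>H\<^esub> (xs ! k) \<otimes>\<^bsub>H\<^esub> xs ! Suc k"
  by (simp add: consecutive_quotients_def)

lemma length_partial_products [simp]: "length (partial_products H g hs) = Suc (length hs)"
  by (induction hs arbitrary: g) auto

lemma partial_products_Suc:
  "k < length hs \<Longrightarrow> partial_products H g hs ! Suc k = partial_products H g hs ! k \<otimes>\<^bsub>H\<^esub> hs ! k"
proof (induction hs arbitrary: g k)
  case (Cons h hs)
  show ?case
  proof (cases k)
    case 0
    then show ?thesis by (cases hs) auto
  next
    case (Suc j)
    then show ?thesis using Cons by simp
  qed
qed simp

context group
begin

abbreviation "T \<equiv> tuples (carrier G)"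
abbreviation "quot \<equiv> consecutive_quotients G"

lemma simplicial_map_quotients: "simplicial_map T (nerve G) quot"
proof -
  have cx: "inv x \<otimes> x = \<one>" if "x \<in> carrier G" for x using that by simp
  show ?thesis unfolding simplicial_map_def
    apply (intro conjI)
    subgoal by (auto simp: simplices_nerve simplices_tuples consecutive_quotients_nth)
    subgoal by (intro allI ballI impI nth_equalityI; auto simp: tuples_simps consecutive_quotients_nth
          length_face_nerve face_nerve_nth inv_mult_telescope)
    subgoal by (intro allI ballI impI nth_equalityI; auto simp: tuples_simps consecutive_quotients_nth
          length_degen_nerve degen_nerve_nth cx)
    done
qed

lemma simplicial_map_translation:
  "g \<in> carrier G \<Longrightarrow> simplicial_map T T (\<lambda>n. map (\<lambda>x. g \<otimes> x))"
  by (intro simplicial_map_tuples) simp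

text \<open>A simplex of the nerve is the sequence of quotients of its partial products.\<close>

lemma quot_surj: "quot n ` simplices T n = simplices (nerve G) n"
proof
  show "quot n ` simplices T n \<subseteq> simplices (nerve G) n"
    using simplicial_map_closed[OF simplicial_map_quotients] by blast
  show "simplices (nerve G) n \<subseteq> quot n ` simplices T n"
  proof
    fix hs assume hs: "hs \<in> simplices (nerve G) n"
    then have l: "length hs = n" and c: "\<And>k. k < n \<Longrightarrow> hs ! k \<in> carrier G"
      by (auto simp: simplices_nerve)
    have pc: "partial_products G \<one> hs ! k \<in> carrier G" if "k \<le> n" for k
      using that
    proof (induction k)
      case 0
      then show ?case by (cases hs) auto
    next
      case (Suc k)
      then show ?case using c l by (simp add: partial_products_Suc)
    qed
    have "hs = quot n (partial_products G \<one> hs)"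
    proof (rule nth_equalityI)
      fix k assume "k < length hs"
      then have k: "k < n" using l by simp
      have "inv p \<otimes> (p \<otimes> h) = h" if "p \<in> carrier G" "h \<in> carrier G" for p h
        using that by (simp flip: m_assoc)
      then show "hs ! k = quot n (partial_products G \<one> hs) ! k"
        using k l pc[of k] c[OF k] by (simp add: consecutive_quotients_nth partial_products_Suc)
    qed (simp add: l)
    moreover have "partial_products G \<one> hs \<in> simplices T n"
      using pc l by (simp add: simplices_tuples)
    ultimately show "hs \<in> quot n ` simplices T n" by blast
  qed
qed

lemma quot_translation:
  assumes "g \<in> carrier G" "xs \<in> simplices T n"
  shows "quot n (map (\<lambda>x. g \<otimes> x) xs) = quot n xs"
proof (rule nth_equalityI)
  fix k assume "k < length (quot n (map (\<lambda>x. g \<otimes> x) xs))"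
  then have k: "k < n" by simp
  have "inv (g \<otimes> x) \<otimes> (g \<otimes> y) = inv x \<otimes> y" if "x \<in> carrier G" "y \<in> carrier G" for x y
    using that assms(1) inv_mult_telescope[of x "inv g" y] by (simp add: inv_mult_group)
  then show "quot n (map (\<lambda>x. g \<otimes> x) xs) ! k = quot n xs ! k"
    using k assms(2) by (simp add: consecutive_quotients_nth simplices_tuples)
qed simp

lemma same_quotients_imp_translate:
  assumes xs: "xs \<in> simplices T n" and ys: "ys \<in> simplices T n" and eq: "quot n xs = quot n ys"
  shows "\<exists>g \<in> carrier G. ys = map (\<lambda>x. g \<otimes> x) xs"
proof -
  have x: "\<And>k. k \<le> n \<Longrightarrow> xs ! k \<in> carrier G" and y: "\<And>k. k \<le> n \<Longrightarrow> ys ! k \<in> carrier G"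
    and l: "length xs = Suc n" "length ys = Suc n"
    using xs ys by (auto simp: simplices_tuples)
  define g where "g = ys ! 0 \<otimes> inv (xs ! 0)"
  have g: "g \<in> carrier G" using x[of 0] y[of 0] by (simp add: g_def)
  have "ys ! k = g \<otimes> xs ! k" if "k \<le> n" for k
    using that
  proof (induction k)
    case 0
    then show ?case using x[of 0] y[of 0] by (simp add: g_def m_assoc)
  next
    case (Suc k)
    have q: "inv (xs ! k) \<otimes> xs ! Suc k = inv (ys ! k) \<otimes> ys ! Suc k"
      using eq Suc.prems by (metis consecutive_quotients_nth Suc_le_lessD)
    have c: "p \<otimes> (inv p \<otimes> r) = r" if "p \<in> carrier G" "r \<in> carrier G" for p r
      using that by (simp flip: m_assoc)
    have "ys ! Suc k = ys ! k \<otimes> (inv (xs ! k) \<otimes> xs ! Suc k)"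
      unfolding q using y Suc.prems by (simp add: c)
    also have "\<dots> = g \<otimes> (xs ! k \<otimes> (inv (xs ! k) \<otimes> xs ! Suc k))"
      using Suc g x[of k] x[of "Suc k"] by (simp add: m_assoc)
    also have "\<dots> = g \<otimes> xs ! Suc k"
      using Suc.prems x by (simp add: c)
    finally show ?case .
  qed
  then have "ys = map (\<lambda>x. g \<otimes> x) xs"
    using l by (intro nth_equalityI) (auto simp: less_Suc_eq_le)
  with g show ?thesis by blast
qed

lemma covering_map_pt:
  "xs \<in> simplices T n \<Longrightarrow> t \<in> standard_simplex n \<Longrightarrow>
    covering_map G (realization_pt T n xs t) = realization_pt (nerve G) n (quot n xs) t"
  unfolding covering_map_def
  by (rule realization_map_pt[OF simplicial_set_nerve[OF is_group] simplicial_map_quotients])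

lemma translation_pt:
  "g \<in> carrier G \<Longrightarrow> xs \<in> simplices T n \<Longrightarrow> t \<in> standard_simplex n \<Longrightarrow>
    translation G g (realization_pt T n xs t) = realization_pt T n (map (\<lambda>x. g \<otimes> x) xs) t"
  unfolding translation_def
  by (rule realization_map_pt[OF simplicial_set_tuples simplicial_map_translation])

text \<open>The candidate for the fibre over a point of a simplex of the nerve; that it is invariant under gluing
  is seen after choosing one preimage of the simplex, whose translates give all others.\<close>

definition fibre_over :: "nat \<Rightarrow> 'a list \<Rightarrow> (nat \<Rightarrow> real) \<Rightarrow> 'a list cell_pt set set" where
  "fibre_over n hs t = {realization_pt T n xs t | xs. xs \<in> simplices T n \<and> quot n xs = hs}"

lemma fibre_over_eq:
  assumes "xs \<in> simplices T n"
  shows "fibre_over n (quot n xs) t = (\<lambda>g. realization_pt T n (map (\<lambda>x. g \<otimes> x) xs) t) ` carrier G"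
proof
  show "fibre_over n (quot n xs) t \<subseteq> (\<lambda>g. realization_pt T n (map (\<lambda>x. g \<otimes> x) xs) t) ` carrier G"
  proof
    fix p assume "p \<in> fibre_over n (quot n xs) t"
    then obtain ys where ys: "p = realization_pt T n ys t" "ys \<in> simplices T n" "quot n xs = quot n ys"
      unfolding fibre_over_def by auto
    with same_quotients_imp_translate[OF assms ys(2,3)]
    show "p \<in> (\<lambda>g. realization_pt T n (map (\<lambda>x. g \<otimes> x) xs) t) ` carrier G" by auto
  qed
  show "(\<lambda>g. realization_pt T n (map (\<lambda>x. g \<otimes> x) xs) t) ` carrier G \<subseteq> fibre_over n (quot n xs) t"
  proof
    fix p assume "p \<in> (\<lambda>g. realization_pt T n (map (\<lambda>x. g \<otimes> x) xs) t) ` carrier G"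
    then obtain g where g: "g \<in> carrier G" "p = realization_pt T n (map (\<lambda>x. g \<otimes> x) xs) t" by auto
    have "map (\<lambda>x. g \<otimes> x) xs \<in> simplices T n"
      by (rule simplicial_map_closed[OF simplicial_map_translation[OF g(1)] assms])
    then show "p \<in> fibre_over n (quot n xs) t"
      unfolding fibre_over_def using g quot_translation[OF g(1) assms]
      by (intro CollectI exI[of _ "map (\<lambda>x. g \<otimes> x) xs"]) simp
  qed
qed

lemma glue_invariant_fibre_over: "glue_invariant (nerve G) fibre_over"
  unfolding glue_invariant_def
proof (intro conjI allI impI)
  fix n i hs and t :: "nat \<Rightarrow> real"
  {
    assume hs: "hs \<in> simplices (nerve G) (Suc n)" and i: "i \<le> Suc n" and t: "t \<in> standard_simplex n"
    obtain xs where xs: "xs \<in> simplices T (Suc n)" "quot (Suc n) xs = hs"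
      using hs unfolding quot_surj[symmetric] by (elim imageE) simp
    have f: "face T (Suc n) i xs \<in> simplices T n"
      using simplicial_set_closed(1)[OF simplicial_set_tuples xs(1) i] .
    have "face (nerve G) (Suc n) i hs = quot n (face T (Suc n) i xs)"
      using simplicial_map_face[OF simplicial_map_quotients xs(1) i] xs(2) by simp
    then have "fibre_over n (face (nerve G) (Suc n) i hs) t
        = (\<lambda>g. realization_pt T n (map (\<lambda>x. g \<otimes> x) (face T (Suc n) i xs)) t) ` carrier G"
      by (simp add: fibre_over_eq[OF f])
    also have "\<dots> = (\<lambda>g. realization_pt T (Suc n) (map (\<lambda>x. g \<otimes> x) xs) (simplical_face i t)) ` carrier G"
    proof (rule image_cong[OF refl])
      fix g assume g: "g \<in> carrier G"
      have "map (\<lambda>x. g \<otimes> x) (face T (Suc n) i xs) = face T (Suc n) i (map (\<lambda>x. g \<otimes> x) xs)"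
        by (rule simplicial_map_face[OF simplicial_map_translation[OF g] xs(1) i])
      then show "realization_pt T n (map (\<lambda>x. g \<otimes> x) (face T (Suc n) i xs)) t
          = realization_pt T (Suc n) (map (\<lambda>x. g \<otimes> x) xs) (simplical_face i t)"
        using realization_pt_face[OF simplicial_set_tuples
            simplicial_map_closed[OF simplicial_map_translation[OF g] xs(1)] i t] by simp
    qed
    also have "\<dots> = fibre_over (Suc n) hs (simplical_face i t)"
      using fibre_over_eq[OF xs(1)] xs(2) by simp
    finally show "fibre_over n (face (nerve G) (Suc n) i hs) t = fibre_over (Suc n) hs (simplical_face i t)" .
  }
  {
    assume hs: "hs \<in> simplices (nerve G) n" and i: "i \<le> n" and t: "t \<in> standard_simplex (Suc n)"
    obtain xs where xs: "xs \<in> simplices T n" "quot n xs = hs"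
      using hs unfolding quot_surj[symmetric] by (elim imageE) simp
    have f: "degen T n i xs \<in> simplices T (Suc n)"
      using simplicial_set_closed(2)[OF simplicial_set_tuples xs(1) i] .
    have "degen (nerve G) n i hs = quot (Suc n) (degen T n i xs)"
      using simplicial_map_degen[OF simplicial_map_quotients xs(1) i] xs(2) by simp
    then have "fibre_over (Suc n) (degen (nerve G) n i hs) t
        = (\<lambda>g. realization_pt T (Suc n) (map (\<lambda>x. g \<otimes> x) (degen T n i xs)) t) ` carrier G"
      by (simp add: fibre_over_eq[OF f])
    also have "\<dots> = (\<lambda>g. realization_pt T n (map (\<lambda>x. g \<otimes> x) xs) (simplical_degen i t)) ` carrier G"
    proof (rule image_cong[OF refl])
      fix g assume g: "g \<in> carrier G"
      have "map (\<lambda>x. g \<otimes> x) (degen T n i xs) = degen T n i (map (\<lambda>x. g \<otimes> x) xs)"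
        by (rule simplicial_map_degen[OF simplicial_map_translation[OF g] xs(1) i])
      then show "realization_pt T (Suc n) (map (\<lambda>x. g \<otimes> x) (degen T n i xs)) t
          = realization_pt T n (map (\<lambda>x. g \<otimes> x) xs) (simplical_degen i t)"
        using realization_pt_degen[OF simplicial_set_tuples
            simplicial_map_closed[OF simplicial_map_translation[OF g] xs(1)] i t] by simp
    qed
    also have "\<dots> = fibre_over n hs (simplical_degen i t)"
      using fibre_over_eq[OF xs(1)] xs(2) by simp
    finally show "fibre_over (Suc n) (degen (nerve G) n i hs) t = fibre_over n hs (simplical_degen i t)" .
  }
qed

text \<open>Equal images have equal candidate fibres, and the candidate fibre over the image of \<open>p\<close> consists of the
  translates of \<open>p\<close>.\<close>

lemma covering_map_fibres:
  assumes p: "p \<in> topspace (universal_cover G)" and q: "q \<in> topspace (universal_cover G)"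
  shows "covering_map G p = covering_map G q \<longleftrightarrow> (\<exists>g \<in> carrier G. q = translation G g p)"
proof -
  obtain n xs t where xs: "xs \<in> simplices T n" "t \<in> standard_simplex n" "p = realization_pt T n xs t"
    using realization_cases p unfolding universal_cover_def by metis
  obtain m ys u where ys: "ys \<in> simplices T m" "u \<in> standard_simplex m" "q = realization_pt T m ys u"
    using realization_cases q unfolding universal_cover_def by metis
  note closed = simplicial_map_closed[OF simplicial_map_quotients]
  show ?thesis
  proof
    assume "covering_map G p = covering_map G q"
    then have "realization_pt (nerve G) n (quot n xs) t = realization_pt (nerve G) m (quot m ys) u"
      using xs ys by (simp add: covering_map_pt)
    then have "fibre_over n (quot n xs) t = fibre_over m (quot m ys) u"
      using glue_invariant_eq[OF glue_invariant_fibre_over _ closed[OF xs(1)] xs(2) closed[OF ys(1)] ys(2)]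
      by blast
    moreover have "q \<in> fibre_over m (quot m ys) u"
      using ys unfolding fibre_over_def by blast
    ultimately have "q \<in> (\<lambda>g. realization_pt T n (map (\<lambda>x. g \<otimes> x) xs) t) ` carrier G"
      by (simp add: fibre_over_eq[OF xs(1)])
    then show "\<exists>g \<in> carrier G. q = translation G g p"
      using xs by (auto simp: translation_pt)
  next
    assume "\<exists>g \<in> carrier G. q = translation G g p"
    then obtain g where g: "g \<in> carrier G" "q = translation G g p" by blast
    have "map (\<lambda>x. g \<otimes> x) xs \<in> simplices T n"
      by (rule simplicial_map_closed[OF simplicial_map_translation[OF g(1)] xs(1)])
    then show "covering_map G p = covering_map G q"
      using xs g by (simp add: translation_pt covering_map_pt quot_translation)
  qed
qed

text \<open>Around a point \<open>e\<close> take the points whose step function agrees with that of \<open>e\<close> on more than half of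
  the unit interval. The step functions of \<open>q\<close> and of a proper translate of \<open>q\<close> differ everywhere, so that
  they cannot both agree with the one of \<open>e\<close> on more than half.\<close>

lemma translation_wandering:
  assumes "e \<in> topspace (universal_cover G)"
  shows "\<exists>U. openin (universal_cover G) U \<and> e \<in> U \<and>
    (\<forall>g \<in> carrier G. \<forall>q \<in> U. translation G g q \<in> U \<longrightarrow> g = \<one>)"
proof -
  obtain m y u where y: "y \<in> simplices T m" "u \<in> standard_simplex m" "e = realization_pt T m y u"
    using realization_cases assms unfolding universal_cover_def by metis
  define \<psi> where "\<psi> = occupation m y u"
  define A where "A = descend (\<lambda>((n, x), t). agreement \<psi> n x t)"
  have A: "A (realization_pt T n x t) = agreement \<psi> n x t"
    if "x \<in> simplices T n" "t \<in> standard_simplex n" for n x t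
    unfolding A_def by (rule descend_realization_pt[OF glue_invariant_agreement that])
  define U where "U = {q \<in> topspace (universal_cover G). A q \<in> {1/2<..}}"
  have "continuous_map (universal_cover G) euclideanreal A"
    unfolding universal_cover_def
  proof (rule continuous_map_realization)
    fix n x assume x: "x \<in> simplices T n"
    have "continuous_map (simplex_top n) euclideanreal (agreement \<psi> n x)"
      unfolding \<psi>_def by (rule continuous_map_agreement[OF continuous_on_occupation])
    then show "continuous_map (simplex_top n) euclideanreal (\<lambda>t. A (realization_pt T n x t))"
      by (rule continuous_map_eq) (simp add: A[OF x])
  qed
  then have "openin (universal_cover G) U"
    unfolding U_def by (rule openin_continuous_map_preimage) simp
  moreover have "e \<in> U"
    using assms agreement_self[OF y(2), of y] A[OF y(1,2)] y(3) by (simp add: U_def \<psi>_def)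
  moreover have "g = \<one>" if g: "g \<in> carrier G" and q: "q \<in> U" "translation G g q \<in> U" for g q
  proof (rule ccontr)
    assume ne: "g \<noteq> \<one>"
    have "q \<in> topspace (universal_cover G)" using q by (simp add: U_def)
    then obtain n x t where x: "x \<in> simplices T n" "t \<in> standard_simplex n" "q = realization_pt T n x t"
      using realization_cases unfolding universal_cover_def by metis
    have gx: "map (\<lambda>x. g \<otimes> x) x \<in> simplices T n"
      by (rule simplicial_map_closed[OF simplicial_map_translation[OF g] x(1)])
    have "x ! i \<noteq> map (\<lambda>x. g \<otimes> x) x ! i" if "i \<le> n" for i
      using that x(1) g ne r_cancel_one'[of "x ! i" g] by (auto simp: simplices_tuples)
    from agreement_disjoint[OF y(2) x(2) this]
    have "A q + A (translation G g q) \<le> 1"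
      using x g gx A by (simp add: translation_pt \<psi>_def)
    moreover have "A q > 1/2" "A (translation G g q) > 1/2" using q by (simp_all add: U_def)
    ultimately show False by simp
  qed
  ultimately show ?thesis by blast
qed

lemma covering_action_universal_cover:
  "covering_action G (universal_cover G) (classifying_space G) (covering_map G) (translation G)"
proof (unfold_locales)
  show "quotient_map (universal_cover G) (classifying_space G) (covering_map G)"
    unfolding universal_cover_def classifying_space_def covering_map_def
    by (rule quotient_map_realization_map[OF simplicial_set_nerve[OF is_group] simplicial_map_quotients quot_surj])
  show "translation G \<one> e = e" if e: "e \<in> topspace (universal_cover G)" for e
  proof -
    obtain n x t where x: "x \<in> simplices T n" "t \<in> standard_simplex n" "e = realization_pt T n x t"
      using realization_cases e[unfolded universal_cover_def] by metis
    have "map (\<lambda>x. \<one> \<otimes> x) x = x" using x(1) by (intro map_idI) (auto simp: tuples_def)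
    then show ?thesis using x by (simp add: translation_pt)
  qed
  show "translation G (g \<otimes> h) e = translation G g (translation G h e)"
    if gh: "g \<in> carrier G" "h \<in> carrier G" and e: "e \<in> topspace (universal_cover G)" for g h e
  proof -
    obtain n x t where x: "x \<in> simplices T n" "t \<in> standard_simplex n" "e = realization_pt T n x t"
      using realization_cases e[unfolded universal_cover_def] by metis
    have hx: "map (\<lambda>x. h \<otimes> x) x \<in> simplices T n"
      by (rule simplicial_map_closed[OF simplicial_map_translation[OF gh(2)] x(1)])
    have "map (\<lambda>x. (g \<otimes> h) \<otimes> x) x = map (\<lambda>x. g \<otimes> x) (map (\<lambda>x. h \<otimes> x) x)"
      using x(1) gh by (auto simp: tuples_def m_assoc)
    then show ?thesis using x gh hx by (simp add: translation_pt del: map_map map_eq_conv)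
  qed
  show "continuous_map (universal_cover G) (universal_cover G) (translation G g)" if "g \<in> carrier G" for g
    unfolding universal_cover_def translation_def
    by (rule continuous_map_realization_map[OF simplicial_set_tuples simplicial_map_translation[OF that]])
qed (fact covering_map_fibres translation_wandering)+

end

section \<open>Edge paths\<close>

lemma edge_pt_in_standard_simplex:
  fixes s :: real
  assumes "s \<in> {0..1}"
  shows "(\<lambda>j. if j = 0 then 1 - s else if j = 1 then s else 0) \<in> standard_simplex 1"
  using assms by (auto simp: standard_simplex_def)

lemma pathin_edge_path:
  assumes "x \<in> simplices X 1"
  shows "pathin (realization X) (edge_path X x)"
proof -
  have "continuous_map (top_of_set {0..1}) (simplex_top 1)
      (\<lambda>s (j::nat). if j = 0 then 1 - s else if j = 1 then s else 0)"
  proof (rule continuous_map_into_subtopology)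
    show "continuous_map (top_of_set {0..1}) (powertop_real UNIV)
        (\<lambda>s (j::nat). if j = 0 then 1 - s else if j = 1 then s else 0)"
      unfolding continuous_map_componentwise_UNIV
    proof
      fix j :: nat
      show "continuous_map (top_of_set {0..1}) euclideanreal (\<lambda>s. if j = 0 then 1 - s else if j = 1 then s else 0)"
        by (cases "j = 0"; cases "j = 1") (auto intro!: continuous_intros)
    qed
    show "(\<lambda>s (j::nat). if j = 0 then 1 - s else if j = 1 then s else 0) \<in> topspace (top_of_set {0..1}) \<rightarrow> standard_simplex 1"
      using edge_pt_in_standard_simplex by auto
  qed
  from continuous_map_compose[OF this continuous_map_realization_pt[OF assms]]
  show ?thesis by (simp add: pathin_def edge_path_def[abs_def] o_def)
qed

lemma edge_path_endpoints:
  assumes X: "simplicial_set X" and x: "x \<in> simplices X 1"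
  shows "edge_path X x 0 = realization_vertex X (face X 1 1 x)"
    and "edge_path X x 1 = realization_vertex X (face X 1 0 x)"
proof -
  let ?e = "\<lambda>j. if j = (0::nat) then 1 else 0 :: real"
  have e: "?e \<in> standard_simplex 0" by simp
  have "simplical_face 1 ?e = (\<lambda>j. if j = 0 then 1 - 0 else if j = 1 then 0 else 0)"
    "simplical_face 0 ?e = (\<lambda>j. if j = 0 then 1 - 1 else if j = 1 then 1 else 0)"
    by (auto simp: simplical_face_def fun_eq_iff)
  then show "edge_path X x 0 = realization_vertex X (face X 1 1 x)"
    "edge_path X x 1 = realization_vertex X (face X 1 0 x)"
    using realization_pt_face[OF X x[unfolded One_nat_def] _ e, of 1]
      realization_pt_face[OF X x[unfolded One_nat_def] _ e, of 0]
    by (simp_all add: edge_path_def realization_vertex_def)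
qed

lemma realization_map_vertex:
  assumes "simplicial_set Y" "simplicial_map X Y f" "v \<in> simplices X 0"
  shows "realization_map Y f (realization_vertex X v) = realization_vertex Y (f 0 v)"
  unfolding realization_vertex_def by (rule realization_map_pt[OF assms]) simp

lemma realization_map_edge_path:
  assumes "simplicial_set Y" "simplicial_map X Y f" "x \<in> simplices X 1" "s \<in> {0..1}"
  shows "realization_map Y f (edge_path X x s) = edge_path Y (f 1 x) s"
  unfolding edge_path_def
  by (rule realization_map_pt[OF assms(1-3) edge_pt_in_standard_simplex[OF assms(4)]])

text \<open>The two paths agree on the unit interval, but a path is a function on all reals, and elsewhere they
  may differ.\<close>

lemma path_homotopic_realization_map_edge_path:
  assumes Y: "simplicial_set Y" and f: "simplicial_map X Y f" and x: "x \<in> simplices X 1"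
  shows "path_homotopic (realization Y) (realization_vertex Y (face Y 1 1 (f 1 x)))
    (realization_vertex Y (face Y 1 0 (f 1 x))) (realization_map Y f \<circ> edge_path X x) (edge_path Y (f 1 x))"
proof -
  have fx: "f 1 x \<in> simplices Y 1" by (rule simplicial_map_closed[OF f x])
  have "path_homotopic (realization Y) (realization_vertex Y (face Y 1 1 (f 1 x)))
      (realization_vertex Y (face Y 1 0 (f 1 x))) (edge_path Y (f 1 x)) (realization_map Y f \<circ> edge_path X x)"
    using edge_path_endpoints[OF Y fx] realization_map_edge_path[OF Y f x]
    by (intro path_homotopic_eq_on[OF pathin_edge_path[OF fx]]) simp_all
  then show ?thesis by (rule path_homotopic_sym)
qed

section \<open>The fundamental group of the classifying space\<close>

lemma simplices_tuples_1: "[x, y] \<in> simplices (tuples S) 1 \<longleftrightarrow> x \<in> S \<and> y \<in> S"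
  by (simp add: tuples_def)

lemma simplices_tuples_0: "[x] \<in> simplices (tuples S) 0 \<longleftrightarrow> x \<in> S"
  by (simp add: tuples_def)

lemma edge_path_tuples:
  assumes "x \<in> S" "y \<in> S"
  shows "pathin (realization (tuples S)) (edge_path (tuples S) [x, y])"
    "edge_path (tuples S) [x, y] 0 = realization_vertex (tuples S) [x]"
    "edge_path (tuples S) [x, y] 1 = realization_vertex (tuples S) [y]"
  using assms pathin_edge_path[of "[x, y]" "tuples S"]
    edge_path_endpoints[OF simplicial_set_tuples, of "[x, y]" S]
  by (simp_all add: simplices_tuples_1 tuples_def)

context group
begin

abbreviation "EG \<equiv> universal_cover G"
abbreviation "BG \<equiv> classifying_space G"
abbreviation "base \<equiv> classifying_base G"
abbreviation "vertex x \<equiv> realization_vertex T [x]"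
abbreviation "edge x y \<equiv> edge_path T [x, y]"
abbreviation "loop_edge h \<equiv> edge_path (nerve G) [h]"

lemma vertex_in_cover: "x \<in> carrier G \<Longrightarrow> vertex x \<in> topspace EG"
  unfolding universal_cover_def realization_vertex_def
  by (intro realization_pt_in_topspace) (simp_all add: simplices_tuples_0)

lemma loop_edge:
  assumes "h \<in> carrier G"
  shows "loop_edge h \<in> loops BG base"
proof -
  have h: "[h] \<in> simplices (nerve G) 1" using assms by (simp add: nerve_def)
  show ?thesis
    using pathin_edge_path[OF h] edge_path_endpoints[OF simplicial_set_nerve[OF is_group] h]
    by (simp add: loops_def classifying_space_def classifying_base_def nerve_def)
qed

lemma covering_map_vertex: "x \<in> carrier G \<Longrightarrow> covering_map G (vertex x) = base"
  unfolding covering_map_def classifying_base_def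
  using realization_map_vertex[OF simplicial_set_nerve[OF is_group] simplicial_map_quotients, of "[x]"]
  by (simp add: simplices_tuples_0 consecutive_quotients_def)

lemma covering_map_edge:
  assumes "x \<in> carrier G" "y \<in> carrier G" "s \<in> {0..1}"
  shows "covering_map G (edge x y s) = loop_edge (inv x \<otimes> y) s"
proof -
  have "quot 1 [x, y] = [inv x \<otimes> y]" by (simp add: consecutive_quotients_def)
  moreover have "[x, y] \<in> simplices T 1" using assms by (simp only: simplices_tuples_1)
  ultimately show ?thesis
    using realization_map_edge_path[OF simplicial_set_nerve[OF is_group] simplicial_map_quotients, of "[x, y]" s]
      assms(3)
    by (simp only: covering_map_def)
qed

lemma translation_vertex:
  "g \<in> carrier G \<Longrightarrow> x \<in> carrier G \<Longrightarrow> translation G g (vertex x) = vertex (g \<otimes> x)"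
  unfolding translation_def
  using realization_map_vertex[OF simplicial_set_tuples simplicial_map_translation, of g "[x]"]
  by (simp add: simplices_tuples_0)

lemma contractible_cover: "contractible_space EG"
  unfolding universal_cover_def by (rule contractible_realization_tuples[OF one_closed])

text \<open>A path in the contractible cover is homotopic to the edge with the same endpoints, and this edge
  projects to the loop given by the quotient of its vertices.\<close>

lemma path_homotopic_project:
  assumes p: "pathin EG p" "p 0 = vertex x" "p 1 = vertex y" and x: "x \<in> carrier G" and y: "y \<in> carrier G"
  shows "path_homotopic BG base base (covering_map G \<circ> p) (loop_edge (inv x \<otimes> y))"
proof -
  interpret cover: covering_action G EG BG "covering_map G" "translation G"
    by (rule covering_action_universal_cover)
  note e = edge_path_tuples[OF x y, folded universal_cover_def]
  have "path_homotopic EG (vertex x) (vertex y) p (edge x y)"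
    by (rule contractible_path_homotopic[OF contractible_cover p e])
  from path_homotopic_compose[OF this cover.continuous_pi]
  have "path_homotopic BG base base (covering_map G \<circ> p) (covering_map G \<circ> edge x y)"
    by (simp add: covering_map_vertex x y)
  also have "path_homotopic BG base base (loop_edge (inv x \<otimes> y)) (covering_map G \<circ> edge x y)"
    using loop_edge[of "inv x \<otimes> y"] x y
    by (intro path_homotopic_eq_on) (auto simp: loops_def covering_map_edge)
  then have "path_homotopic BG base base (covering_map G \<circ> edge x y) (loop_edge (inv x \<otimes> y))"
    by (rule path_homotopic_sym)
  finally show ?thesis .
qed

text \<open>The path along the edges from \<open>1\<close> to \<open>x\<close> and on to \<open>x y\<close> projects to the product of the two loops.\<close>

lemma loop_edge_mult:
  assumes x: "x \<in> carrier G" and y: "y \<in> carrier G"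
  shows "path_homotopic BG base base (loop_join (loop_edge x) (loop_edge y)) (loop_edge (x \<otimes> y))"
proof -
  have xy: "x \<otimes> y \<in> carrier G" using x y by simp
  note e1 = edge_path_tuples[OF one_closed x, folded universal_cover_def]
    and e2 = edge_path_tuples[OF x xy, folded universal_cover_def]
  have e: "edge \<one> x 1 = edge x (x \<otimes> y) 0" using e1 e2 by simp
  have "path_homotopic BG base base (covering_map G \<circ> loop_join (edge \<one> x) (edge x (x \<otimes> y)))
      (loop_edge (inv \<one> \<otimes> (x \<otimes> y)))"
    using pathin_loop_join[OF e1(1) e2(1) e] e1 e2 xy by (intro path_homotopic_project) simp_all
  then have join: "path_homotopic BG base base
      (loop_join (covering_map G \<circ> edge \<one> x) (covering_map G \<circ> edge x (x \<otimes> y))) (loop_edge (x \<otimes> y))"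
    using xy by (simp add: comp_loop_join)
  have "path_homotopic BG base base (covering_map G \<circ> edge \<one> x) (loop_edge (inv \<one> \<otimes> x))"
    using e1 x by (intro path_homotopic_project) simp_all
  moreover have "inv \<one> \<otimes> x = x" using x by simp
  ultimately have a: "path_homotopic BG base base (covering_map G \<circ> edge \<one> x) (loop_edge x)"
    by simp
  have "path_homotopic BG base base (covering_map G \<circ> edge x (x \<otimes> y)) (loop_edge (inv x \<otimes> (x \<otimes> y)))"
    using e2 x xy by (intro path_homotopic_project) simp_all
  moreover have "inv x \<otimes> (x \<otimes> y) = y" using x y by (simp flip: m_assoc)
  ultimately have b: "path_homotopic BG base base (covering_map G \<circ> edge x (x \<otimes> y)) (loop_edge y)"
    by simp
  show ?thesis
    by (rule path_homotopic_trans[OF path_homotopic_sym[OF path_homotopic_loop_join[OF a b]] join])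
qed

text \<open>The loop given by \<open>x\<close> lifts to the edge from \<open>1\<close> to \<open>x\<close>. Homotopic loops have lifts with the same
  endpoint, which gives injectivity. The lift of an arbitrary loop ends at some vertex \<open>g\<close> because the
  vertices are the fibre over the base point; so the loop is homotopic to the one given by \<open>g\<close>.\<close>

lemma edge_loop_class_iso: "edge_loop_class G \<in> iso G (pi1_B G)"
proof -
  interpret cover: covering_action G EG BG "covering_map G" "translation G"
    by (rule covering_action_universal_cover)
  have lift_edge: "cover.lift {0..1} (loop_edge x) (edge \<one> x)" if "x \<in> carrier G" for x
    using edge_path_tuples(1)[OF one_closed that, folded universal_cover_def] that
    by (simp add: cover.lift_def covering_map_edge pathin_def)
  have hom: "edge_loop_class G \<in> hom G (pi1_B G)"
  proof (rule homI)
    fix x y assume x: "x \<in> carrier G" and y: "y \<in> carrier G"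
    show "edge_loop_class G x \<in> carrier (pi1_B G)"
      using loop_edge[OF x] by (auto simp: edge_loop_class_def fundamental_group_carrier)
    show "edge_loop_class G (x \<otimes> y) = edge_loop_class G x \<otimes>\<^bsub>pi1_B G\<^esub> edge_loop_class G y"
      unfolding edge_loop_class_def
      by (simp add: fundamental_group_mult[OF loop_edge[OF x] loop_edge[OF y]]
          loop_class_eq[OF loop_edge_mult[OF x y]])
  qed
  have inj: "x = y" if x: "x \<in> carrier G" and y: "y \<in> carrier G"
    and eq: "edge_loop_class G x = edge_loop_class G y" for x y
  proof -
    have "path_homotopic BG base base (loop_edge x) (loop_edge y)"
      using eq by (simp add: edge_loop_class_def loop_class_eq_iff[OF loop_edge[OF x]])
    from cover.path_homotopic_lift_endpoints[OF this lift_edge[OF x] lift_edge[OF y]]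
    have "vertex x = vertex y"
      using edge_path_tuples[OF one_closed x] edge_path_tuples[OF one_closed y] by simp
    moreover have "y \<otimes> inv x \<otimes> x = y" using x y by (simp add: m_assoc)
    ultimately have "translation G (y \<otimes> inv x) (vertex x) = vertex x"
      using translation_vertex[of "y \<otimes> inv x" x] x y by simp
    then have "y \<otimes> inv x = \<one>"
      using x y by (intro cover.act_free[OF _ vertex_in_cover[OF x]]) simp_all
    then show "x = y" using x y by (metis inv_equality inv_inv inv_closed)
  qed
  have surj: "A \<in> edge_loop_class G ` carrier G" if A: "A \<in> carrier (pi1_B G)" for A
  proof -
    obtain p where p: "p \<in> loops BG base" "A = loop_class BG base p"
      using A by (auto simp: fundamental_group_carrier)
    have "pathin BG p" "p 0 = base" "p 1 = base" using p(1) by (auto simp: loops_def)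
    then obtain p' where p': "cover.lift {0..1} p p'" "p' 0 = vertex \<one>"
      using cover.lift_path[of p "vertex \<one>"] vertex_in_cover covering_map_vertex one_closed by metis
    have "p' 1 \<in> topspace EG" "covering_map G (vertex \<one>) = covering_map G (p' 1)"
      using cover.lift_in_topspace[OF p'(1), of 1] p'(1) \<open>p 1 = base\<close>
      by (simp_all add: cover.lift_def covering_map_vertex)
    then obtain g where g: "g \<in> carrier G" "p' 1 = translation G g (vertex \<one>)"
      using cover.fibres[OF vertex_in_cover[OF one_closed]] by blast
    then have "p' 1 = vertex g" by (simp add: translation_vertex)
    then have "path_homotopic BG base base (covering_map G \<circ> p') (loop_edge (inv \<one> \<otimes> g))"
      using p' g(1) by (intro path_homotopic_project) (simp_all add: cover.lift_def pathin_def)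
    moreover have "path_homotopic BG base base p (covering_map G \<circ> p')"
      using p(1) p'(1) by (intro path_homotopic_eq_on) (auto simp: loops_def cover.lift_def)
    ultimately have "path_homotopic BG base base p (loop_edge g)"
      using g(1) by (auto intro: path_homotopic_trans)
    then have "A = edge_loop_class G g"
      by (simp add: p(2) edge_loop_class_def loop_class_eq)
    with g(1) show ?thesis by blast
  qed
  have "edge_loop_class G ` carrier G = carrier (pi1_B G)"
    using hom surj by (auto simp: hom_def Pi_iff)
  with hom inj show ?thesis
    unfolding iso_def bij_betw_def inj_on_def by blast
qed

end

section \<open>The commutator map on fundamental groups\<close>

context group
begin

lemma group_commutator_subgroup: "group (commutator_subgroup G)"
  unfolding commutator_subgroup_def
  by (rule subgroup.subgroup_is_group[OF derived_is_subgroup[OF subset_refl] is_group])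

lemma carrier_commutator_subgroup: "carrier (commutator_subgroup G) = derived G (carrier G)"
  by (simp add: commutator_subgroup_def)

lemma comm_map_base: "comm_map G (E_com_base G) = classifying_base (commutator_subgroup G)"
proof -
  have "[\<one>] \<in> simplices (AfCom G) 0" by (simp add: AfCom_def affinely_commutative_def)
  from realization_map_vertex[OF simplicial_set_nerve[OF group_commutator_subgroup] simplicial_map_comm[OF is_group] this]
  show ?thesis
    by (simp add: comm_map_def E_com_base_def classifying_base_def comm_simp_def)
qed

lemma continuous_map_comm_map:
  "continuous_map (E_com G) (classifying_space (commutator_subgroup G)) (comm_map G)"
  unfolding E_com_def classifying_space_def comm_map_def
  by (rule continuous_map_realization_map[OF simplicial_set_nerve[OF group_commutator_subgroup]
        simplicial_map_comm[OF is_group]])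

lemma comm_star_hom: "comm_star G \<in> hom (pi1_E_com G) (pi1_B (commutator_subgroup G))"
  unfolding comm_star_def using induced_map_hom[OF continuous_map_comm_map, of "E_com_base G"]
  by (simp add: comm_map_base)

lemma comm_star_loop_class:
  assumes "p \<in> loops (E_com G) (E_com_base G)"
  shows "comm_star G (loop_class (E_com G) (E_com_base G) p)
    = loop_class (classifying_space (commutator_subgroup G)) (classifying_base (commutator_subgroup G)) (comm_map G \<circ> p)"
  unfolding comm_star_def using induced_map_loop_class[OF continuous_map_comm_map assms]
  by (simp add: comm_map_base)

lemma edge_path_AfCom:
  assumes "x \<in> carrier G" "y \<in> carrier G"
  shows "pathin (E_com G) (edge_path (AfCom G) [x, y])"
    "edge_path (AfCom G) [x, y] 0 = realization_vertex (AfCom G) [x]"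
    "edge_path (AfCom G) [x, y] 1 = realization_vertex (AfCom G) [y]"
    "path_homotopic (classifying_space (commutator_subgroup G)) (classifying_base (commutator_subgroup G))
      (classifying_base (commutator_subgroup G)) (comm_map G \<circ> edge_path (AfCom G) [x, y])
      (edge_path (nerve (commutator_subgroup G)) [commutator G x y])"
proof -
  have xy: "[x, y] \<in> simplices (AfCom G) 1"
    using assms by (simp add: AfCom_def affinely_commutative_def)
  show "pathin (E_com G) (edge_path (AfCom G) [x, y])"
    unfolding E_com_def by (rule pathin_edge_path[OF xy])
  show "edge_path (AfCom G) [x, y] 0 = realization_vertex (AfCom G) [x]"
    "edge_path (AfCom G) [x, y] 1 = realization_vertex (AfCom G) [y]"
    using edge_path_endpoints[OF simplicial_set_AfCom[OF is_group] xy] by (simp_all add: AfCom_def)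
  show "path_homotopic (classifying_space (commutator_subgroup G)) (classifying_base (commutator_subgroup G))
      (classifying_base (commutator_subgroup G)) (comm_map G \<circ> edge_path (AfCom G) [x, y])
      (edge_path (nerve (commutator_subgroup G)) [commutator G x y])"
    using path_homotopic_realization_map_edge_path[OF simplicial_set_nerve[OF group_commutator_subgroup]
        simplicial_map_comm[OF is_group] xy]
    by (simp add: classifying_space_def classifying_base_def comm_map_def comm_simp_def nerve_def)
qed

lemma commutator_one: "x \<in> carrier G \<Longrightarrow> commutator G \<one> x = \<one>" "x \<in> carrier G \<Longrightarrow> commutator G x \<one> = \<one>"
  by (simp_all add: commutator_def)

text \<open>The triangle through the vertices \<open>1\<close>, \<open>x\<close> and \<open>y\<close> is mapped to the loops given by \<open>[1, x]\<close>, \<open>[x, y]\<close> and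
  \<open>[y, 1]\<close>, and the first and the last of these commutators are \<open>1\<close>.\<close>

lemma commutator_in_image:
  assumes x: "x \<in> carrier G" and y: "y \<in> carrier G"
  shows "edge_loop_class (commutator_subgroup G) (commutator G x y) \<in> comm_star G ` carrier (pi1_E_com G)"
proof -
  let ?D = "commutator_subgroup G"
  interpret D: group ?D by (rule group_commutator_subgroup)
  let ?B = "classifying_space ?D" and ?b = "classifying_base ?D"
  let ?l = "\<lambda>h. edge_path (nerve ?D) [h]"
  note e1 = edge_path_AfCom[OF one_closed x] and e2 = edge_path_AfCom[OF x y]
    and e3 = edge_path_AfCom[OF y one_closed]
  define p where "p = loop_join (loop_join (edge_path (AfCom G) [\<one>, x]) (edge_path (AfCom G) [x, y]))
    (edge_path (AfCom G) [y, \<one>])"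
  have p12: "pathin (E_com G) (loop_join (edge_path (AfCom G) [\<one>, x]) (edge_path (AfCom G) [x, y]))"
    "loop_join (edge_path (AfCom G) [\<one>, x]) (edge_path (AfCom G) [x, y]) 0 = realization_vertex (AfCom G) [\<one>]"
    "loop_join (edge_path (AfCom G) [\<one>, x]) (edge_path (AfCom G) [x, y]) 1 = realization_vertex (AfCom G) [y]"
    using pathin_loop_join[OF e1(1) e2(1)] e1 e2 by simp_all
  have p: "p \<in> loops (E_com G) (E_com_base G)"
    using pathin_loop_join[OF p12(1) e3(1)] p12 e3 by (simp add: loops_def p_def E_com_base_def)
  have one: "\<one> = \<one>\<^bsub>?D\<^esub>" by (simp add: commutator_subgroup_def)
  have c: "commutator G x y \<in> carrier ?D"
    using commutator_in_derived[OF x y] by (simp add: carrier_commutator_subgroup)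
  have "path_homotopic ?B ?b ?b (comm_map G \<circ> p) (loop_join (loop_join (?l \<one>) (?l (commutator G x y))) (?l \<one>))"
    using path_homotopic_loop_join[OF path_homotopic_loop_join[OF e1(4) e2(4)] e3(4)] x y
    by (simp add: p_def comp_loop_join commutator_one)
  also have "path_homotopic ?B ?b ?b \<dots> (loop_join (?l (\<one> \<otimes>\<^bsub>?D\<^esub> commutator G x y)) (?l \<one>))"
    unfolding one using D.loop_edge[OF D.one_closed, unfolded mem_loops]
    by (rule path_homotopic_loop_join[OF D.loop_edge_mult[OF D.one_closed c]])
  also have "path_homotopic ?B ?b ?b \<dots> (?l (\<one> \<otimes>\<^bsub>?D\<^esub> commutator G x y \<otimes>\<^bsub>?D\<^esub> \<one>))"
    unfolding one by (rule D.loop_edge_mult[OF D.m_closed[OF D.one_closed c] D.one_closed])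
  also have "\<one> \<otimes>\<^bsub>?D\<^esub> commutator G x y \<otimes>\<^bsub>?D\<^esub> \<one> = commutator G x y"
    unfolding one using c by simp
  finally have "comm_star G (loop_class (E_com G) (E_com_base G) p) = edge_loop_class ?D (commutator G x y)"
    unfolding comm_star_loop_class[OF p] edge_loop_class_def by (rule loop_class_eq)
  moreover have "loop_class (E_com G) (E_com_base G) p \<in> carrier (pi1_E_com G)"
    using p by (auto simp: fundamental_group_carrier)
  ultimately show ?thesis by (metis imageI)
qed

lemma one_in_image:
  "edge_loop_class (commutator_subgroup G) \<one> \<in> comm_star G ` carrier (pi1_E_com G)"
  using commutator_in_image[OF one_closed one_closed] by (simp add: commutator_one)

lemma pi1_E_com_mult_closed:
  "A \<in> carrier (pi1_E_com G) \<Longrightarrow> B \<in> carrier (pi1_E_com G) \<Longrightarrow> A \<otimes>\<^bsub>pi1_E_com G\<^esub> B \<in> carrier (pi1_E_com G)"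
  by (auto simp: fundamental_group_carrier fundamental_group_mult intro!: loop_join_loops bexI)

text \<open>The inverse of a commutator is again a commutator, so that closure under products suffices.\<close>

lemma derived_in_image:
  assumes "d \<in> derived G (carrier G)"
  shows "edge_loop_class (commutator_subgroup G) d \<in> comm_star G ` carrier (pi1_E_com G)"
  using assms unfolding derived_def
proof (induction rule: generate.induct)
  case one
  show ?case by (rule one_in_image)
next
  case (incl h)
  then obtain x y where "x \<in> carrier G" "y \<in> carrier G" "h = x \<otimes> y \<otimes> inv x \<otimes> inv y" by auto
  then have "h = commutator G (inv x) (inv y)" "inv x \<in> carrier G" "inv y \<in> carrier G"
    by (simp_all add: commutator_def)
  then show ?case using commutator_in_image by simp
next
  case (inv h)
  then obtain x y where "x \<in> carrier G" "y \<in> carrier G" "h = x \<otimes> y \<otimes> inv x \<otimes> inv y" by auto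
  then have "inv h = commutator G (inv y) (inv x)" "inv x \<in> carrier G" "inv y \<in> carrier G"
    by (simp_all add: commutator_def inv_mult_group m_assoc)
  then show ?case using commutator_in_image by simp
next
  case (eng h k)
  let ?D = "commutator_subgroup G"
  interpret D: group ?D by (rule group_commutator_subgroup)
  obtain A B where AB: "A \<in> carrier (pi1_E_com G)" "edge_loop_class ?D h = comm_star G A"
    "B \<in> carrier (pi1_E_com G)" "edge_loop_class ?D k = comm_star G B"
    using eng.IH by blast
  have "h \<in> carrier ?D" "k \<in> carrier ?D"
    using eng.hyps by (simp_all add: carrier_commutator_subgroup derived_def)
  then have "edge_loop_class ?D (h \<otimes>\<^bsub>?D\<^esub> k) = edge_loop_class ?D h \<otimes>\<^bsub>pi1_B ?D\<^esub> edge_loop_class ?D k"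
    by (rule hom_mult[OF iso_imp_homomorphism[OF D.edge_loop_class_iso]])
  also have "\<dots> = comm_star G (A \<otimes>\<^bsub>pi1_E_com G\<^esub> B)"
    unfolding AB by (rule hom_mult[OF comm_star_hom AB(1,3), symmetric])
  finally show ?case
    using pi1_E_com_mult_closed[OF AB(1,3)] by (simp add: commutator_subgroup_def)
qed

lemma comm_star_epi:
  "pi1_B_identification (commutator_subgroup G) \<circ> comm_star G \<in> epi (pi1_E_com G) (commutator_subgroup G)"
proof -
  let ?D = "commutator_subgroup G" and ?\<phi> = "pi1_B_identification (commutator_subgroup G)"
  interpret D: group ?D by (rule group_commutator_subgroup)
  have \<phi>: "?\<phi> \<in> iso (pi1_B ?D) ?D"
    unfolding pi1_B_identification_def by (rule D.iso_set_sym[OF D.edge_loop_class_iso])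
  have hom: "?\<phi> \<circ> comm_star G \<in> hom (pi1_E_com G) ?D"
    by (rule Group.hom_compose[OF comm_star_hom iso_imp_homomorphism[OF \<phi>]])
  have inj: "inj_on (edge_loop_class ?D) (carrier ?D)"
    using D.edge_loop_class_iso by (simp add: iso_def bij_betw_def)
  have "d \<in> (?\<phi> \<circ> comm_star G) ` carrier (pi1_E_com G)" if d: "d \<in> carrier ?D" for d
  proof -
    obtain A where "A \<in> carrier (pi1_E_com G)" "edge_loop_class ?D d = comm_star G A"
      using derived_in_image[of d] d by (auto simp: carrier_commutator_subgroup)
    moreover have "?\<phi> (edge_loop_class ?D d) = d"
      unfolding pi1_B_identification_def by (rule inv_into_f_f[OF inj d])
    ultimately show ?thesis by (metis comp_apply imageI)
  qed
  with hom show ?thesis unfolding epi_def by (auto simp: hom_def Pi_iff)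
qed

lemma comm_group_iff_derived_trivial: "comm_group G \<longleftrightarrow> derived G (carrier G) = {\<one>}"
proof
  assume "comm_group G"
  then interpret comm_group G .
  have "(\<Union>h \<in> carrier G. \<Union>k \<in> carrier G. {h \<otimes> k \<otimes> inv h \<otimes> inv k}) \<subseteq> {\<one>}"
  proof clarsimp
    fix h k assume hk: "h \<in> carrier G" "k \<in> carrier G"
    have "h \<otimes> k \<otimes> inv h \<otimes> inv k = (h \<otimes> k) \<otimes> inv (k \<otimes> h)"
      using hk by (simp add: inv_mult_group m_assoc)
    also have "\<dots> = \<one>"
      unfolding m_comm[OF hk(2,1)] using hk by simp
    finally show "h \<otimes> k \<otimes> inv h \<otimes> inv k = \<one>" .
  qed
  then have "derived G (carrier G) \<subseteq> generate G {\<one>}"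
    unfolding derived_def by (rule mono_generate)
  also have "\<dots> = {\<one>}" by (rule generate_one)
  finally show "derived G (carrier G) = {\<one>}"
    unfolding derived_def using generate.one by blast
next
  assume tr: "derived G (carrier G) = {\<one>}"
  have "x \<otimes> y = y \<otimes> x" if x: "x \<in> carrier G" and y: "y \<in> carrier G" for x y
  proof -
    have "commutator G x y = \<one>" using commutator_in_derived[OF x y] tr by simp
    then have "(y \<otimes> x) \<otimes> (inv x \<otimes> inv y \<otimes> x \<otimes> y) = y \<otimes> x"
      using x y by (simp add: commutator_def)
    moreover have c: "p \<otimes> (inv p \<otimes> r) = r" if "p \<in> carrier G" "r \<in> carrier G" for p r
      using that by (simp flip: m_assoc)
    have "(y \<otimes> x) \<otimes> (inv x \<otimes> inv y \<otimes> x \<otimes> y) = x \<otimes> y"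
      using x y by (simp add: m_assoc c)
    ultimately show ?thesis by simp
  qed
  then show "comm_group G" by (intro group_comm_groupI) auto
qed

lemma AfCom_abelian:
  assumes "comm_group G"
  shows "AfCom G = T"
proof -
  interpret comm_group G by fact
  have "affinely_commutative G gs" if "set gs \<subseteq> carrier G" for gs
    using that by (auto simp: affinely_commutative_def subset_iff intro!: m_comm)
  then show ?thesis by (auto simp: AfCom_def tuples_def)
qed

lemma pi1_E_com_trivial:
  assumes "comm_group G"
  shows "trivial_group (pi1_E_com G)"
proof -
  have X: "contractible_space (E_com G)"
    unfolding E_com_def AfCom_abelian[OF assms] by (rule contractible_realization_tuples[OF one_closed])
  let ?c = "\<lambda>_. E_com_base G"
  have b: "E_com_base G \<in> topspace (E_com G)"
    unfolding E_com_base_def E_com_def realization_vertex_def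
    by (intro realization_pt_in_topspace) (simp_all add: AfCom_def affinely_commutative_def)
  then have c: "?c \<in> loops (E_com G) (E_com_base G)" by (simp add: loops_def pathin_def)
  have class_eq: "loop_class (E_com G) (E_com_base G) p = \<one>\<^bsub>pi1_E_com G\<^esub>"
    if "p \<in> loops (E_com G) (E_com_base G)" for p
  proof -
    have "path_homotopic (E_com G) (E_com_base G) (E_com_base G) p ?c"
      using that c by (intro contractible_path_homotopic[OF X]) (auto simp: loops_def)
    then show ?thesis by (simp add: loop_class_eq fundamental_group_def)
  qed
  have carrier: "carrier (pi1_E_com G) = {\<one>\<^bsub>pi1_E_com G\<^esub>}"
    using class_eq c by (auto simp: fundamental_group_carrier)
  moreover have "\<one>\<^bsub>pi1_E_com G\<^esub> \<otimes>\<^bsub>pi1_E_com G\<^esub> \<one>\<^bsub>pi1_E_com G\<^esub> = \<one>\<^bsub>pi1_E_com G\<^esub>"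
    using pi1_E_com_mult_closed[of "\<one>\<^bsub>pi1_E_com G\<^esub>" "\<one>\<^bsub>pi1_E_com G\<^esub>"] carrier by simp
  ultimately have "group (pi1_E_com G)" by (intro groupI) auto
  with carrier show ?thesis by (simp add: trivial_group_def)
qed

end

theorem theorem1:
  fixes G :: "('a, 'b) monoid_scheme"
  assumes "group G"
  shows "edge_loop_class (commutator_subgroup G)
           \<in> iso (commutator_subgroup G) (pi1_B (commutator_subgroup G)) \<and>
         comm_star G \<in> hom (pi1_E_com G) (pi1_B (commutator_subgroup G)) \<and>
         pi1_B_identification (commutator_subgroup G) \<circ> comm_star G
           \<in> epi (pi1_E_com G) (commutator_subgroup G) \<and>
         (comm_group G \<longleftrightarrow> trivial_group (pi1_E_com G))"
proof (intro conjI iffI)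
  interpret group G by fact
  interpret D: group "commutator_subgroup G" by (rule group_commutator_subgroup)
  show "edge_loop_class (commutator_subgroup G)
      \<in> iso (commutator_subgroup G) (pi1_B (commutator_subgroup G))"
    by (rule D.edge_loop_class_iso)
  show "comm_star G \<in> hom (pi1_E_com G) (pi1_B (commutator_subgroup G))"
    by (rule comm_star_hom)
  show epi: "pi1_B_identification (commutator_subgroup G) \<circ> comm_star G
      \<in> epi (pi1_E_com G) (commutator_subgroup G)"
    by (rule comm_star_epi)
  show "trivial_group (pi1_E_com G)" if "comm_group G"
    using that by (rule pi1_E_com_trivial)
  show "comm_group G" if "trivial_group (pi1_E_com G)"
  proof -
    have "carrier (pi1_E_com G) = {\<one>\<^bsub>pi1_E_com G\<^esub>}"
      using that by (simp add: trivial_group_def)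
    moreover have "(pi1_B_identification (commutator_subgroup G) \<circ> comm_star G) ` carrier (pi1_E_com G)
        = derived G (carrier G)"
      using epi unfolding epi_def carrier_commutator_subgroup by (elim CollectE conjE)
    ultimately obtain d where "derived G (carrier G) = {d}"
      by (metis image_empty image_insert)
    moreover have "\<one>\<^bsub>G\<^esub> \<in> derived G (carrier G)"
      unfolding derived_def by (rule generate.one)
    ultimately show ?thesis by (simp add: comm_group_iff_derived_trivial)
  qed
qed

end
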